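(* Suppose $\sigma,\theta,\mu$ are cardinals with $\sigma$ and $\theta$ regular, $\mu$ singular, and $\aleph_0<\sigma\leq\mathrm{cf}(\mu)<\theta<\mu$, and suppose $\mathrm{pp}_{\Gamma(\theta,\sigma)}(\mu)$ is a weakly inaccessible cardinal $\kappa$. If $\kappa\notin\mathrm{PP}_{\Gamma(\theta,\sigma)}(\mu)$, then there is a progressive set $A\subseteq\mu\cap\mathrm{Reg}$ such that $\mathrm{pcf}_{\Gamma^*(\theta,\sigma)}(A)$ is an unbounded subset of $\kappa$.
   Context: $\mathrm{Reg}$ denotes the class of regular cardinals. A set $A$ of regular cardinals is progressive if $|A|<\min(A)$. $\prod A$ is the set of functions $f$ on $A$ with $f(a)<a$; $\mathrm{tcf}(\prod A/J)=\lambda$ means there is a sequence of length $\lambda$ in $\prod A$, increasing and cofinal modulo the ideal $J$. An ideal is $\sigma$-complete if closed under unions of fewer than $\sigma$ sets. $J^{\mathrm{bd}}[A]$ is the ideal of subsets of $A$ bounded in $\sup(A)$. $\mathrm{pcf}_{\Gamma^*(\theta,\sigma)}(A)$ is the set of cardinals $\lambda$ such that $\lambda=\mathrm{tcf}(\prod A/J)$ for some $\sigma$-complete ideal $J\supseteq J^{\mathrm{bd}}[A]$ on $A$ whose dual filter contains a set of cardinality $<\theta$. For $\mu$ singular and $\sigma=\mathrm{cf}(\sigma)\leq\mathrm{cf}(\mu)<\theta\leq\mu$, $\mathrm{PP}_{\Gamma(\theta,\sigma)}(\mu)$ is the set of cardinals $\lambda$ such that there are a cofinal $A\subseteq\mu\cap\mathrm{Reg}$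 with $|A|<\theta$ and a $\sigma$-complete ideal $J$ on $A$ containing all bounded subsets of $A$ with $\lambda=\mathrm{tcf}(\prod A/J)$; $\mathrm{pp}_{\Gamma(\theta,\sigma)}(\mu)=\sup\mathrm{PP}_{\Gamma(\theta,\sigma)}(\mu)$. *)

theory Defs
  imports Main "HOL-Library.FuncSet"
begin

unbundle cardinal_syntax

text \<open>
  Cardinals are card orders in the sense of the HOL library, considered up to \<open>=o\<close>.
  The ordinals below a cardinal \<open>\<mu> :: 'a rel\<close> are the elements of \<open>Field \<mu>\<close>; the element
  \<open>a\<close> stands for the order type of the initial segment \<open>seg \<mu> a\<close>, and sets of ordinals
  below \<open>\<mu>\<close> are subsets of \<open>Field \<mu>\<close>.
\<close>

definition seg :: "'a rel \<Rightarrow> 'a \<Rightarrow> 'a rel" where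
  "seg r a = Restr r (underS r a)"

definition regular_cardinal :: "'a rel \<Rightarrow> bool" where
  "regular_cardinal r \<longleftrightarrow> Cinfinite r \<and> regularCard r"

definition singular_cardinal :: "'a rel \<Rightarrow> bool" where
  "singular_cardinal r \<longleftrightarrow> Cinfinite r \<and> \<not> regularCard r"

definition weakly_inaccessible :: "'a rel \<Rightarrow> bool" where
  "weakly_inaccessible \<kappa> \<longleftrightarrow> regular_cardinal \<kappa> \<and> natLeq <o \<kappa> \<and>
     (\<forall>\<nu> :: 'a rel. Card_order \<nu> \<and> \<nu> <o \<kappa> \<longrightarrow> cardSuc \<nu> <o \<kappa>)"

definition cf :: "'a rel \<Rightarrow> 'a rel" where
  "cf r = |SOME K. K \<subseteq> Field r \<and> cofinal K r \<and>
             (\<forall>K'. K' \<subseteq> Field r \<and> cofinal K' r \<longrightarrow> |K| \<le>o |K'| )|"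

definition card_sup :: "'a rel set \<Rightarrow> 'a rel" where
  "card_sup S = (SOME \<kappa>. Card_order \<kappa> \<and> (\<forall>\<rho>\<in>S. \<rho> \<le>o \<kappa>) \<and>
     (\<forall>\<nu> :: 'a rel. Card_order \<nu> \<and> (\<forall>\<rho>\<in>S. \<rho> \<le>o \<nu>) \<longrightarrow> \<kappa> \<le>o \<nu>))"

definition Reg_below :: "'a rel \<Rightarrow> 'a set" where
  "Reg_below \<mu> = {a \<in> Field \<mu>. regular_cardinal (seg \<mu> a)}"

definition progressive :: "'a rel \<Rightarrow> 'a set \<Rightarrow> bool" where
  "progressive \<mu> A \<longleftrightarrow> A \<noteq> {} \<and> A \<subseteq> Reg_below \<mu> \<and> |A| <o seg \<mu> (wo_rel.minim \<mu> A)"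

definition ideal_on :: "'a set \<Rightarrow> 'a set set \<Rightarrow> bool" where
  "ideal_on A J \<longleftrightarrow> J \<subseteq> Pow A \<and> {} \<in> J \<and> A \<notin> J \<and>
     (\<forall>X\<in>J. \<forall>Y. Y \<subseteq> X \<longrightarrow> Y \<in> J) \<and> (\<forall>X\<in>J. \<forall>Y\<in>J. X \<union> Y \<in> J)"

definition complete_ideal :: "'s rel \<Rightarrow> 'a set set \<Rightarrow> bool" where
  "complete_ideal \<sigma> J \<longleftrightarrow> (\<forall>S. S \<subseteq> J \<and> |S| <o \<sigma> \<longrightarrow> \<Union>S \<in> J)"

text \<open>
  The ordinal \<open>sup A\<close> need not be an element of \<open>Field \<mu>\<close>, so \<open>\<beta> < sup A\<close> is written as
  \<open>\<exists>a\<in>A. \<beta> < a\<close>.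
\<close>

definition Jbd :: "'a rel \<Rightarrow> 'a set \<Rightarrow> 'a set set" where
  "Jbd \<mu> A = {B. B \<subseteq> A \<and> (\<exists>\<beta>. (\<exists>a\<in>A. \<beta> \<in> underS \<mu> a) \<and> B \<subseteq> underS \<mu> \<beta>)}"

definition prod_ord :: "'a rel \<Rightarrow> 'a set \<Rightarrow> ('a \<Rightarrow> 'a) set" where
  "prod_ord \<mu> A = (\<Pi>\<^sub>E a\<in>A. underS \<mu> a)"

definition less_mod :: "'a rel \<Rightarrow> 'a set \<Rightarrow> 'a set set \<Rightarrow> ('a \<Rightarrow> 'a) \<Rightarrow> ('a \<Rightarrow> 'a) \<Rightarrow> bool" where
  "less_mod \<mu> A J f g \<longleftrightarrow> {a \<in> A. f a \<notin> underS \<mu> (g a)} \<in> J"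

definition le_mod :: "'a rel \<Rightarrow> 'a set \<Rightarrow> 'a set set \<Rightarrow> ('a \<Rightarrow> 'a) \<Rightarrow> ('a \<Rightarrow> 'a) \<Rightarrow> bool" where
  "le_mod \<mu> A J f g \<longleftrightarrow> {a \<in> A. f a \<notin> under \<mu> (g a)} \<in> J"

text \<open>
  \<open>is_tcf \<mu> A J \<rho>\<close> means \<open>tcf(\<Prod>A/J) = \<rho>\<close>. As usual a true cofinality is a regular
  cardinal; this makes \<open>\<rho>\<close> unique up to \<open>=o\<close>.
\<close>

definition is_tcf :: "'a rel \<Rightarrow> 'a set \<Rightarrow> 'a set set \<Rightarrow> 'b rel \<Rightarrow> bool" where
  "is_tcf \<mu> A J \<rho> \<longleftrightarrow> regular_cardinal \<rho> \<and>
     (\<exists>f :: 'b \<Rightarrow> 'a \<Rightarrow> 'a.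
        (\<forall>i\<in>Field \<rho>. f i \<in> prod_ord \<mu> A) \<and>
        (\<forall>i\<in>Field \<rho>. \<forall>j\<in>Field \<rho>. i \<in> underS \<rho> j \<longrightarrow> less_mod \<mu> A J (f i) (f j)) \<and>
        (\<forall>g\<in>prod_ord \<mu> A. \<exists>i\<in>Field \<rho>. le_mod \<mu> A J g (f i)))"

text \<open>
  A true cofinality of a product of ordinals below \<open>\<mu>\<close> is at most \<open>2^|\<mu>|\<close>, so the card
  orders on the type \<open>'a set\<close> represent all of them (see \<open>is_tcf_ordLeq\<close> below).
\<close>

definition PP_Gamma :: "'t rel \<Rightarrow> 's rel \<Rightarrow> 'a rel \<Rightarrow> 'a set rel set" where
  "PP_Gamma \<theta> \<sigma> \<mu> = {\<rho>. \<exists>A J. A \<subseteq> Reg_below \<mu> \<and> cofinal A \<mu> \<and> |A| <o \<theta> \<and>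
     ideal_on A J \<and> complete_ideal \<sigma> J \<and> Jbd \<mu> A \<subseteq> J \<and> is_tcf \<mu> A J \<rho>}"

definition pp_Gamma :: "'t rel \<Rightarrow> 's rel \<Rightarrow> 'a rel \<Rightarrow> 'a set rel" where
  "pp_Gamma \<theta> \<sigma> \<mu> = card_sup (PP_Gamma \<theta> \<sigma> \<mu>)"

definition pcf_Gamma_star :: "'t rel \<Rightarrow> 's rel \<Rightarrow> 'a rel \<Rightarrow> 'a set \<Rightarrow> 'a set rel set" where
  "pcf_Gamma_star \<theta> \<sigma> \<mu> A = {\<rho>. \<exists>J. ideal_on A J \<and> complete_ideal \<sigma> J \<and> Jbd \<mu> A \<subseteq> J \<and>
     (\<exists>B. B \<subseteq> A \<and> A - B \<in> J \<and> |B| <o \<theta>) \<and> is_tcf \<mu> A J \<rho>}"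

definition unbounded_subset :: "'a rel set \<Rightarrow> 'a rel \<Rightarrow> bool" where
  "unbounded_subset S \<kappa> \<longleftrightarrow> (\<forall>\<rho>\<in>S. \<rho> <o \<kappa>) \<and>
     (\<forall>\<beta> :: 'a rel. Well_order \<beta> \<and> \<beta> <o \<kappa> \<longrightarrow> (\<exists>\<rho>\<in>S. \<beta> <o \<rho>))"

lemma cf_props:
  assumes "Cinfinite (r :: 'a rel)"
  shows "\<exists>K. K \<subseteq> Field r \<and> cofinal K r \<and> cf r = |K|"
    and "K' \<subseteq> Field r \<Longrightarrow> cofinal K' r \<Longrightarrow> cf r \<le>o |K'|"
proof -
  let ?C = "{K. K \<subseteq> Field r \<and> cofinal K r}"
  have "Field r \<in> ?C"
    using assms infinite_Card_order_limit[of r] unfolding cofinal_def cinfinite_def by blast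
  then have "card_of ` ?C \<noteq> {}" by blast
  then obtain c where c: "c \<in> card_of ` ?C" "\<forall>c'\<in>card_of ` ?C. c \<le>o c'"
    using exists_minim_Card_order[of "card_of ` ?C"] card_of_Card_order by blast
  then have ex: "\<exists>K. K \<subseteq> Field r \<and> cofinal K r \<and>
             (\<forall>K'. K' \<subseteq> Field r \<and> cofinal K' r \<longrightarrow> |K| \<le>o |K'| )" by blast
  from someI_ex[OF ex] show "\<exists>K. K \<subseteq> Field r \<and> cofinal K r \<and> cf r = |K|"
    unfolding cf_def by blast
  from someI_ex[OF ex] show "K' \<subseteq> Field r \<Longrightarrow> cofinal K' r \<Longrightarrow> cf r \<le>o |K'|"
    unfolding cf_def by blast
qed

lemma card_sup_props:
  fixes S :: "'a rel set"
  assumes "\<forall>\<rho>\<in>S. Card_order \<rho>"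
  shows "Card_order (card_sup S)"
    and "\<rho> \<in> S \<Longrightarrow> \<rho> \<le>o card_sup S"
    and "Card_order (\<nu> :: 'a rel) \<Longrightarrow> \<forall>\<rho>\<in>S. \<rho> \<le>o \<nu> \<Longrightarrow> card_sup S \<le>o \<nu>"
proof -
  let ?U = "{\<kappa> :: 'a rel. Card_order \<kappa> \<and> (\<forall>\<rho>\<in>S. \<rho> \<le>o \<kappa>)}"
  have "\<rho> \<le>o |UNIV :: 'a set|" if "\<rho> \<in> S" for \<rho>
    by (rule ordIso_ordLeq_trans[OF ordIso_symmetric[OF card_of_Field_ordIso] card_of_mono1])
      (use assms that in auto)
  then have "|UNIV :: 'a set| \<in> ?U" by (simp add: card_of_Card_order)
  then have "?U \<noteq> {}" by blast
  then obtain k where "k \<in> ?U" "\<forall>k'\<in>?U. k \<le>o k'"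
    using exists_minim_Card_order[of ?U] by blast
  then have ex: "\<exists>\<kappa> :: 'a rel. Card_order \<kappa> \<and> (\<forall>\<rho>\<in>S. \<rho> \<le>o \<kappa>) \<and>
     (\<forall>\<nu> :: 'a rel. Card_order \<nu> \<and> (\<forall>\<rho>\<in>S. \<rho> \<le>o \<nu>) \<longrightarrow> \<kappa> \<le>o \<nu>)"
    by (intro exI[of _ k]) simp
  note * = someI_ex[OF ex, folded card_sup_def]
  show "Card_order (card_sup S)" "\<rho> \<in> S \<Longrightarrow> \<rho> \<le>o card_sup S"
    "Card_order (\<nu> :: 'a rel) \<Longrightarrow> \<forall>\<rho>\<in>S. \<rho> \<le>o \<nu> \<Longrightarrow> card_sup S \<le>o \<nu>"
    using * by blast+
qed

lemma is_tcf_ordLeq: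
  fixes \<mu> :: "'a rel" and \<rho> :: "'b rel"
  assumes \<mu>: "Cinfinite \<mu>" and A: "A \<subseteq> Field \<mu>" and J: "ideal_on A J" and t: "is_tcf \<mu> A J \<rho>"
  shows "\<rho> \<le>o |UNIV :: 'a set set|"
proof -
  obtain f where f: "\<And>i. i \<in> Field \<rho> \<Longrightarrow> f i \<in> prod_ord \<mu> A"
    and inc: "\<And>i j. i \<in> Field \<rho> \<Longrightarrow> j \<in> Field \<rho> \<Longrightarrow> i \<in> underS \<rho> j \<Longrightarrow> less_mod \<mu> A J (f i) (f j)"
    using t unfolding is_tcf_def by blast
  have c: "Card_order \<rho>" using t unfolding is_tcf_def regular_cardinal_def by blast
  have irr: "\<not> less_mod \<mu> A J g g" for g
    using J unfolding less_mod_def underS_def ideal_on_def by simp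
  have inj: "inj_on f (Field \<rho>)"
  proof (rule inj_onI, rule ccontr)
    fix i j assume ij: "i \<in> Field \<rho>" "j \<in> Field \<rho>" "f i = f j" "i \<noteq> j"
    then have "i \<in> underS \<rho> j \<or> j \<in> underS \<rho> i"
      using c unfolding card_order_on_def well_order_on_def linear_order_on_def total_on_def underS_def
      by blast
    then show False using inc[of i j] inc[of j i] ij irr[of "f j"] by auto
  qed
  have 1: "\<rho> =o |Field \<rho>|" using c card_of_Field_ordIso ordIso_symmetric by blast
  have 2: "|Field \<rho>| \<le>o |UNIV :: ('a \<times> 'a) set set|"
  proof -
    have "inj_on (\<lambda>i. {(a, f i a) | a. True}) (Field \<rho>)"
      using inj by (auto simp: inj_on_def fun_eq_iff set_eq_iff) 
    then show ?thesis by (rule card_of_ordLeqI) simp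
  qed
  have 3: "|UNIV :: ('a \<times> 'a) set set| \<le>o |UNIV :: 'a set set|"
  proof -
    have "infinite (UNIV :: 'a set)" using \<mu> unfolding cinfinite_def
      by (auto dest: finite_subset[OF subset_UNIV])
    then have "|(UNIV :: 'a set) \<times> (UNIV :: 'a set)| =o |UNIV :: 'a set|"
      by (rule card_of_Times_same_infinite)
    then have "\<exists>h. bij_betw h ((UNIV :: 'a set) \<times> (UNIV :: 'a set)) (UNIV :: 'a set)"
      by (simp only: card_of_ordIso)
    then obtain h :: "'a \<times> 'a \<Rightarrow> 'a" where "bij h"
      unfolding UNIV_Times_UNIV by blast
    then have "inj (\<lambda>X. h ` X)" by (simp add: bij_is_inj inj_on_image)
    then show ?thesis by (rule card_of_ordLeqI) simp
  qed
  show ?thesis by (rule ordIso_ordLeq_trans[OF 1 ordLeq_transitive[OF 2 3]])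
qed

end

theory Submission
  imports Defs
begin

text \<open>
  Suppose no progressive set works. Every progressive cofinal \<open>A \<subseteq> \<mu> \<inter> Reg\<close> then has
  \<open>pcf\<^bsub>\<Gamma>*(\<theta>,\<sigma>)\<^esub>(A)\<close> bounded in \<open>\<kappa>\<close>, and this yields fewer than \<open>\<kappa>\<close> functions in \<open>\<Prod>A\<close> such that
  every \<open>g \<in> \<Prod>A\<close> is, on any set of size \<open>< \<theta>\<close> and up to a bounded set, below the supremum of
  fewer than \<open>\<sigma>\<close> of them: if \<open>g\<close> were a counterexample, the sets where \<open>g\<close> is dominated would
  generate a \<open>\<sigma>\<close>-complete ideal, which extends to one with a true cofinality, and along that ideal
  \<open>g\<close> is dominated by a sequence that is universal for this cofinality.

  Since \<open>\<kappa>\<close> is regular and larger than \<open>\<mu>\<close>, one can close off under these functions: there is a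
  family \<open>X\<close> of fewer than \<open>\<kappa>\<close> subsets of \<open>\<mu>\<close> of size \<open>< \<mu>\<close> such that every set of fewer than \<open>\<theta>\<close>
  ordinals is covered by fewer than \<open>\<sigma>\<close> members of \<open>X\<close>. Given \<open>N \<in> X\<close> and an ordinal \<open>x \<notin> N\<close>, one of
  fewer than \<open>\<sigma>\<close> refinements of \<open>N\<close> in \<open>X\<close> contains a better upper approximation of \<open>x\<close>, and
  approximations cannot decrease forever; this is where \<open>\<sigma> > \<aleph>\<^sub>0\<close> enters. Now let \<open>\<lambda> > |X|\<close> be the true
  cofinality of \<open>\<Prod>C/J\<close> with \<open>|C| < \<theta>\<close>. By \<open>\<sigma>\<close>-completeness each function in \<open>\<Prod>C\<close> takes values in
  a single \<open>N \<in> X\<close> on a \<open>J\<close>-positive set, hence is there below \<open>a \<mapsto> sup (N \<inter> a)\<close>. These are fewer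
  than \<open>\<lambda>\<close> functions, so some function lies above all of them, a contradiction.
\<close>

section \<open>Well-orders, regular cardinals and ideals\<close>

lemma notin_under_iff:
  assumes "Well_order r" "x \<in> Field r" "y \<in> Field r"
  shows "x \<notin> under r y \<longleftrightarrow> y \<in> underS r x"
  using assms wo_rel.TOTALS[of r] wo_rel.ANTISYM[of r]
  unfolding wo_rel_def under_def underS_def antisym_def by blast

lemma under_trans: "Well_order r \<Longrightarrow> x \<in> under r y \<Longrightarrow> y \<in> under r z \<Longrightarrow> x \<in> under r z"
  using wo_rel.TRANS[of r] unfolding wo_rel_def under_def trans_def by blast

lemma underS_under_trans: "Well_order r \<Longrightarrow> x \<in> underS r y \<Longrightarrow> y \<in> under r z \<Longrightarrow> x \<in> underS r z"
  using wo_rel.TRANS[of r] wo_rel.ANTISYM[of r]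
  unfolding wo_rel_def under_def underS_def trans_def antisym_def by blast

lemma under_underS_trans: "Well_order r \<Longrightarrow> x \<in> under r y \<Longrightarrow> y \<in> underS r z \<Longrightarrow> x \<in> underS r z"
  using wo_rel.TRANS[of r] wo_rel.ANTISYM[of r]
  unfolding wo_rel_def under_def underS_def trans_def antisym_def by blast

lemma underS_imp_under: "x \<in> underS r y \<Longrightarrow> x \<in> under r y"
  unfolding under_def underS_def by blast

lemma underS_irrefl: "x \<notin> underS r x"
  unfolding underS_def by blast

lemma underS_in_Field: "x \<in> underS r y \<Longrightarrow> x \<in> Field r \<and> y \<in> Field r"
  unfolding underS_def Field_def by blast

lemma under_refl: "Well_order r \<Longrightarrow> x \<in> Field r \<Longrightarrow> x \<in> under r x"
  using wo_rel.REFL[of r] unfolding wo_rel_def under_def refl_on_def by blast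

lemma underS_total:
  assumes "Well_order r" "x \<in> Field r" "y \<in> Field r" "x \<noteq> y"
  shows "x \<in> underS r y \<or> y \<in> underS r x"
  using assms wo_rel.TOTALS[of r] unfolding wo_rel_def underS_def by blast

lemma Card_order_Well_order: "Card_order r \<Longrightarrow> Well_order r"
  unfolding card_order_on_def by blast

lemma regular_cardinal_Cinfinite: "regular_cardinal \<rho> \<Longrightarrow> Cinfinite \<rho>"
  and regular_cardinal_Card_order: "regular_cardinal \<rho> \<Longrightarrow> Card_order \<rho>"
  and regular_cardinal_Well_order: "regular_cardinal \<rho> \<Longrightarrow> Well_order \<rho>"
  unfolding regular_cardinal_def card_order_on_def by blast+

lemma regular_cardinal_ordIso:
  "regular_cardinal \<rho> \<Longrightarrow> \<rho> =o \<rho>' \<Longrightarrow> regular_cardinal \<rho>'"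
  unfolding regular_cardinal_def using regularCard_ordIso Cinfinite_cong by blast

lemma regular_cardinal_bound:
  assumes \<rho>: "regular_cardinal \<rho>" and S: "S \<subseteq> Field \<rho>" "|S| <o \<rho>"
  shows "\<exists>i\<in>Field \<rho>. S \<subseteq> underS \<rho> i"
proof -
  have "\<not> cofinal S \<rho>"
    using \<rho> S not_ordLess_ordIso unfolding regular_cardinal_def regularCard_def by blast
  then obtain a where a: "a \<in> Field \<rho>" "\<forall>b\<in>S. a = b \<or> (a,b) \<notin> \<rho>"
    unfolding cofinal_def by blast
  \<comment> \<open>\<open>cofinal\<close> asks for strictly larger elements, so its failure yields
    only a weak bound \<open>a\<close>; moving one point up makes the bound strict.\<close>
  obtain i where i: "i \<in> Field \<rho>" "a \<in> underS \<rho> i"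
    using infinite_Card_order_limit[of \<rho> a] regular_cardinal_Cinfinite[OF \<rho>] a(1)
    unfolding cinfinite_def underS_def by blast
  have wo: "Well_order \<rho>" by (rule regular_cardinal_Well_order[OF \<rho>])
  have "b \<in> underS \<rho> i" if "b \<in> S" for b
  proof -
    have "b \<in> under \<rho> a"
      using that a S(1) notin_under_iff[OF wo, of b a] unfolding underS_def by blast
    then show ?thesis using i(2) under_underS_trans[OF wo] by blast
  qed
  then show ?thesis using i(1) by blast
qed

lemma Field_seg: "Well_order \<mu> \<Longrightarrow> Field (seg \<mu> a) = underS \<mu> a"
  unfolding seg_def by (simp add: Field_Restr_ofilter wo_rel.underS_ofilter wo_rel_def)

lemma underS_seg:
  assumes "Well_order \<mu>" "b \<in> underS \<mu> a"
  shows "underS (seg \<mu> a) b = underS \<mu> b"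
proof -
  have "underS \<mu> b \<subseteq> underS \<mu> a"
    using underS_under_trans[OF assms(1) _ underS_imp_under[OF assms(2)]] by blast
  then show ?thesis using assms(2) unfolding seg_def underS_def by fast
qed

lemma Reg_below_bound:
  assumes wo: "Well_order \<mu>" and a: "a \<in> Reg_below \<mu>"
    and S: "S \<subseteq> underS \<mu> a" "|S| <o seg \<mu> a"
  shows "\<exists>b\<in>underS \<mu> a. S \<subseteq> underS \<mu> b"
proof -
  have "regular_cardinal (seg \<mu> a)" using a unfolding Reg_below_def by blast
  from regular_cardinal_bound[OF this _ S(2)] S(1) show ?thesis
    using Field_seg[OF wo, of a] underS_seg[OF wo] by auto
qed

lemma Reg_below_card:
  assumes wo: "Well_order \<mu>" and a: "a \<in> Reg_below \<mu>"
  shows "|underS \<mu> a| =o seg \<mu> a"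
  using a card_of_Field_ordIso[of "seg \<mu> a"] Field_seg[OF wo, of a] 
  unfolding Reg_below_def regular_cardinal_def by auto

section \<open>Unions, closures and recursion below a regular cardinal\<close>

lemma regular_cardinal_UNION:
  assumes "regular_cardinal \<rho>" "|I| <o \<rho>" "\<And>i. i \<in> I \<Longrightarrow> |F i| <o \<rho>"
  shows "|\<Union>i\<in>I. F i| <o \<rho>"
  using assms card_of_UNION_ordLess_infinite_Field_regularCard
  unfolding regular_cardinal_def by blast

lemma finite_card_of_ordLess: "finite X \<Longrightarrow> Cinfinite \<rho> \<Longrightarrow> |X| <o \<rho>"
  using Cfinite_ordLess_Cinfinite[of "|X|" \<rho>]
  by (simp add: cfinite_def Field_card_of card_of_Card_order card_of_card_order_on)

text \<open>Countably many rounds of applying \<open>T\<close> suffice: regularity keeps each stage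
  below \<rho>, and uncountability keeps their union below \<rho>. The lemma serves \<kappa>, to
  build the family \<open>X\<close>, and \<sigma>, to collect the members of \<open>X\<close>
  visited by a descent.\<close>

lemma small_closed_set:
  fixes T :: "'x \<Rightarrow> 'x set" and \<rho> :: "'r rel"
  assumes \<rho>: "regular_cardinal \<rho>" and unc: "natLeq <o \<rho>"
    and T: "\<And>x. x \<in> D \<Longrightarrow> T x \<subseteq> D \<and> |T x| <o \<rho>" and x0: "x0 \<in> D"
  shows "\<exists>X. x0 \<in> X \<and> X \<subseteq> D \<and> |X| <o \<rho> \<and> (\<forall>x\<in>X. T x \<subseteq> X)"
proof -
  define Y where "Y n = ((\<lambda>Z. \<Union>x\<in>Z. T x) ^^ n) {x0}" for n :: nat
  have Y0: "Y 0 = {x0}" and YS: "Y (Suc n) = (\<Union>x\<in>Y n. T x)" for n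
    unfolding Y_def by simp_all
  have fin: "|{x0}| <o \<rho>"
    by (rule finite_card_of_ordLess[OF _ regular_cardinal_Cinfinite[OF \<rho>]]) simp
  have Y: "Y n \<subseteq> D \<and> |Y n| <o \<rho>" for n
  proof (induction n)
    case 0 then show ?case using x0 fin by (simp add: Y0)
  next
    case (Suc n)
    then show ?case unfolding YS using T by (intro conjI regular_cardinal_UNION[OF \<rho>]) blast+
  qed
  have "|UNIV :: nat set| <o \<rho>" using card_of_nat unc ordIso_ordLess_trans by blast
  then have "|\<Union>n. Y n| <o \<rho>" by (rule regular_cardinal_UNION[OF \<rho>]) (use Y in blast)
  moreover have "T x \<subseteq> (\<Union>n. Y n)" if "x \<in> (\<Union>n. Y n)" for x
    using that YS by blast
  moreover have "x0 \<in> (\<Union>n. Y n)" using Y0 by blast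
  ultimately show ?thesis using Y by (intro exI[of _ "\<Union>n. Y n"]) blast
qed

text \<open>Meant for recursions in which the next value exists only if the earlier values meet
  their own requirements; \<open>cong\<close> says that a requirement looks at earlier values
  only.\<close>

lemma transfinite_choice:
  fixes r :: "'i rel" and Q :: "'i \<Rightarrow> ('i \<Rightarrow> 'b) \<Rightarrow> 'b \<Rightarrow> bool"
  assumes wo: "Well_order r"
    and cong: "\<And>i f g y. (\<And>j. j \<in> underS r i \<Longrightarrow> f j = g j) \<Longrightarrow> Q i f y = Q i g y"
    and step: "\<And>i f. i \<in> Field r \<Longrightarrow> (\<And>j. j \<in> underS r i \<Longrightarrow> Q j f (f j)) \<Longrightarrow> \<exists>y. Q i f y"
  shows "\<exists>f. \<forall>i\<in>Field r. Q i f (f i)"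
proof -
  have wf: "wf (r - Id)" using wo unfolding well_order_on_def by blast
  have "\<exists>f. \<forall>i. i \<in> Field r \<longrightarrow> Q i f (f i)"
  proof (rule dependent_wf_choice[OF wf])
    fix f g :: "'i \<Rightarrow> 'b" and i y assume "\<And>z. (z, i) \<in> r - Id \<Longrightarrow> f z = g z"
    then show "(i \<in> Field r \<longrightarrow> Q i f y) = (i \<in> Field r \<longrightarrow> Q i g y)"
      using cong[of i f g y] unfolding underS_def by blast
  next
    fix i and f :: "'i \<Rightarrow> 'b"
    assume "\<And>y. (y, i) \<in> r - Id \<Longrightarrow> y \<in> Field r \<longrightarrow> Q y f (f y)"
    then show "\<exists>y. i \<in> Field r \<longrightarrow> Q i f y"
      using step[of i f] unfolding underS_def Field_def by blast
  qed
  then show ?thesis by blast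
qed

section \<open>Ideals and the ideal of bounded sets\<close>

lemma ideal_onD:
  assumes "ideal_on A J"
  shows "X \<in> J \<Longrightarrow> Y \<subseteq> X \<Longrightarrow> Y \<in> J" "X \<in> J \<Longrightarrow> Y \<in> J \<Longrightarrow> X \<union> Y \<in> J" "A \<notin> J" "{} \<in> J"
    "X \<in> J \<Longrightarrow> X \<subseteq> A"
  using assms unfolding ideal_on_def by blast+

lemma is_tcf_ordIso:
  assumes t: "is_tcf \<mu> A J \<rho>" and iso: "\<rho> =o \<rho>'"
  shows "is_tcf \<mu> A J \<rho>'"
proof -
  obtain f where reg: "regular_cardinal \<rho>" and f: "\<forall>i\<in>Field \<rho>. f i \<in> prod_ord \<mu> A"
    and inc: "\<forall>i\<in>Field \<rho>. \<forall>j\<in>Field \<rho>. i \<in> underS \<rho> j \<longrightarrow> less_mod \<mu> A J (f i) (f j)"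
    and cof: "\<forall>g\<in>prod_ord \<mu> A. \<exists>i\<in>Field \<rho>. le_mod \<mu> A J g (f i)"
    using t unfolding is_tcf_def by blast
  obtain h where h: "iso \<rho>' \<rho> h" using iso ordIso_symmetric unfolding ordIso_def by blast
  have wo: "Well_order \<rho>" "Well_order \<rho>'"
    using iso unfolding ordIso_def by auto
  have bij: "bij_betw h (Field \<rho>') (Field \<rho>)" using h unfolding iso_def by blast
  have emb: "i \<in> underS \<rho>' j \<Longrightarrow> h i \<in> underS \<rho> (h j)" for i j
    using h wo underS_in_Field[of i \<rho>' j] embed_underS[of \<rho>' \<rho> h j]
    unfolding iso_def bij_betw_def by blast
  have hF: "i \<in> Field \<rho>' \<Longrightarrow> h i \<in> Field \<rho>" for i using bij bij_betwE by blast
  show ?thesis unfolding is_tcf_def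
  proof (intro conjI exI[of _ "\<lambda>i. f (h i)"] ballI impI)
    show "regular_cardinal \<rho>'" by (rule regular_cardinal_ordIso[OF reg iso])
    fix g assume "g \<in> prod_ord \<mu> A"
    then obtain i where "i \<in> Field \<rho>" "le_mod \<mu> A J g (f i)" using cof by blast
    moreover then obtain i' where "i' \<in> Field \<rho>'" "i = h i'" using bij unfolding bij_betw_def by blast
    ultimately show "\<exists>i\<in>Field \<rho>'. le_mod \<mu> A J g (f (h i))" by blast
  qed (use f inc emb hF in blast)+
qed

text \<open>A cofinal \<open>A\<close> has supremum \<mu>, so the bound that \<open>Jbd\<close>
  wants below some member of \<open>A\<close> may be any element of
  \<open>Field \<mu>\<close>.\<close>

lemma Jbd_iff:
  assumes "cofinal A \<mu>"
  shows "B \<in> Jbd \<mu> A \<longleftrightarrow> B \<subseteq> A \<and> (\<exists>t\<in>Field \<mu>. B \<subseteq> underS \<mu> t)"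
proof
  assume "B \<in> Jbd \<mu> A"
  then obtain t a where "B \<subseteq> A" "t \<in> underS \<mu> a" "B \<subseteq> underS \<mu> t" unfolding Jbd_def by blast
  then show "B \<subseteq> A \<and> (\<exists>t\<in>Field \<mu>. B \<subseteq> underS \<mu> t)" using underS_in_Field[of t \<mu> a] by blast
next
  assume "B \<subseteq> A \<and> (\<exists>t\<in>Field \<mu>. B \<subseteq> underS \<mu> t)"
  then obtain t where t: "B \<subseteq> A" "t \<in> Field \<mu>" "B \<subseteq> underS \<mu> t" by blast
  then obtain a where "a \<in> A" "t \<in> underS \<mu> a"
    using assms unfolding cofinal_def underS_def by blast
  then show "B \<in> Jbd \<mu> A" unfolding Jbd_def using t by blast
qed

lemma bound_below_cf:
  assumes \<mu>: "Cinfinite \<mu>" and T: "T \<subseteq> Field \<mu>" "|T| <o cf \<mu>"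
  shows "\<exists>s\<in>Field \<mu>. \<forall>t\<in>T. t \<in> under \<mu> s"
proof -
  have "\<not> cofinal T \<mu>" using cf_props(2)[OF \<mu> T(1)] T(2) not_ordLess_ordLeq by blast
  then obtain s where s: "s \<in> Field \<mu>" "\<forall>t\<in>T. s = t \<or> (s, t) \<notin> \<mu>"
    unfolding cofinal_def by blast
  have wo: "Well_order \<mu>" using \<mu> Card_order_Well_order by blast
  have "t \<in> under \<mu> s" if "t \<in> T" for t
    using that s T(1) notin_under_iff[OF wo, of t s] unfolding underS_def by blast
  then show ?thesis using s(1) by blast
qed

text \<open>Fewer than \<open>cf \<mu>\<close> chosen bounds have a common bound. Since \<sigma>
  \<le> \<open>cf \<mu>\<close>, this is what will make ideals built from the bounded one
  \<sigma>-complete.\<close>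

lemma Jbd_Union:
  assumes \<mu>: "Cinfinite \<mu>" and cof: "cofinal A \<mu>" and S: "S \<subseteq> Jbd \<mu> A" "|S| <o cf \<mu>"
  shows "\<Union>S \<in> Jbd \<mu> A"
proof -
  have wo: "Well_order \<mu>" using \<mu> Card_order_Well_order by blast
  have "\<exists>t\<in>Field \<mu>. B \<subseteq> A \<and> B \<subseteq> underS \<mu> t" if "B \<in> S" for B
    using S(1) that Jbd_iff[OF cof, of B] by blast
  then obtain t where t: "\<And>B. B \<in> S \<Longrightarrow> t B \<in> Field \<mu> \<and> B \<subseteq> A \<and> B \<subseteq> underS \<mu> (t B)" by metis
  have "|t ` S| <o cf \<mu>" using card_of_image S(2) ordLeq_ordLess_trans by blast
  then obtain s where s: "s \<in> Field \<mu>" "\<forall>x\<in>t ` S. x \<in> under \<mu> s"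
    using bound_below_cf[OF \<mu>, of "t ` S"] t by blast
  have "x \<in> A \<and> x \<in> underS \<mu> s" if "B \<in> S" "x \<in> B" for B x
    using t[OF that(1)] s(2) that underS_under_trans[OF wo, of x "t B" s] by blast
  then show ?thesis using Jbd_iff[OF cof, of "\<Union>S"] s(1) by blast
qed

section \<open>Initial segments as ordinals\<close>

lemma seg_seg:
  assumes "Well_order \<mu>" "b \<in> underS \<mu> a"
  shows "seg (seg \<mu> a) b = seg \<mu> b"
proof -
  have "underS \<mu> b \<subseteq> underS \<mu> a"
    using underS_under_trans[OF assms(1) _ underS_imp_under[OF assms(2)]] by blast
  then show ?thesis using underS_seg[OF assms] unfolding seg_def by auto
qed

lemma Well_order_seg: "Well_order \<mu> \<Longrightarrow> Well_order (seg \<mu> a)"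
  unfolding seg_def by (rule Well_order_Restr)

lemma ordLess_ordIso_seg:
  assumes "Well_order r" "r' <o r"
  shows "\<exists>a\<in>Field r. r' =o seg r a"
proof -
  have "Well_order r'" using assms(2) unfolding ordLess_def by auto
  then show ?thesis using ordLess_iff_ordIso_Restr[OF assms(1), of r'] assms(2) unfolding seg_def by simp
qed

lemma seg_ordLess: "Well_order r \<Longrightarrow> a \<in> Field r \<Longrightarrow> seg r a <o r"
  unfolding seg_def by (rule underS_Restr_ordLess) auto

section \<open>Products of regular cardinals modulo ideals\<close>

text \<open>The condition \<open>large\<close> goes one cardinal beyond progressiveness, so that
  even \<open>|A|^+\<close> functions have a pointwise bound; recursions of this length are the main
  tool.\<close>

locale pcf_product =
  fixes \<mu> :: "'a rel" and A :: "'a set"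
  assumes Cinf: "Cinfinite \<mu>" and inf: "infinite A" and Reg: "A \<subseteq> Reg_below \<mu>"
    and large: "\<And>a. a \<in> A \<Longrightarrow> cardSuc |A| <o seg \<mu> a"
begin

abbreviation "P \<equiv> prod_ord \<mu> A"

definition bounded_mod :: "'a set set \<Rightarrow> ('a \<Rightarrow> 'a) set \<Rightarrow> bool" where
  "bounded_mod J F \<longleftrightarrow> (\<exists>h\<in>P. \<forall>f\<in>F. le_mod \<mu> A J f h)"

definition directed_mod :: "'a set set \<Rightarrow> 'b rel \<Rightarrow> bool" where
  "directed_mod J \<delta> \<longleftrightarrow> (\<forall>F. F \<subseteq> P \<and> |F| <o \<delta> \<longrightarrow> bounded_mod J F)"

lemma wo: "Well_order \<mu>"
  using Cinf Card_order_Well_order by blast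

lemma P_underS: "f \<in> P \<Longrightarrow> a \<in> A \<Longrightarrow> f a \<in> underS \<mu> a"
  unfolding prod_ord_def by blast

lemma P_Field: "f \<in> P \<Longrightarrow> a \<in> A \<Longrightarrow> f a \<in> Field \<mu>"
  using P_underS underS_in_Field by metis

lemma Cinfinite_cardSuc_A: "Cinfinite (cardSuc |A| )"
  using inf by (intro Cinfinite_cardSuc) (simp add: cinfinite_def Field_card_of card_of_Card_order card_of_card_order_on)

section \<open>Pointwise bounds and comparison modulo an ideal\<close>

text \<open>At each \<open>a\<close> there are at most \<open>|A|^+\<close> values, too few to be
  unbounded in the larger regular cardinal \<open>a\<close>.\<close>

lemma pointwise_bound:
  assumes G: "G \<subseteq> P" "|G| \<le>o cardSuc |A|"
  shows "\<exists>h\<in>P. \<forall>g\<in>G. \<forall>a\<in>A. g a \<in> underS \<mu> (h a)"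
proof -
  have "\<exists>b\<in>underS \<mu> a. (\<lambda>g. g a) ` G \<subseteq> underS \<mu> b" if a: "a \<in> A" for a
  proof (rule Reg_below_bound[OF wo])
    show "a \<in> Reg_below \<mu>" using a Reg by blast
    show "(\<lambda>g. g a) ` G \<subseteq> underS \<mu> a" using G(1) P_underS a by blast
    show "|(\<lambda>g. g a) ` G| <o seg \<mu> a"
      using card_of_image[of "\<lambda>g. g a" G] G(2) large[OF a]
      by (meson ordLeq_transitive ordLeq_ordLess_trans)
  qed
  then obtain b where b: "\<And>a. a \<in> A \<Longrightarrow> b a \<in> underS \<mu> a \<and> (\<lambda>g. g a) ` G \<subseteq> underS \<mu> (b a)"
    by metis
  have "restrict b A \<in> P" unfolding prod_ord_def using b by auto
  moreover have "\<forall>g\<in>G. \<forall>a\<in>A. g a \<in> underS \<mu> (restrict b A a)" using b by auto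
  ultimately show ?thesis by blast
qed

lemma finite_pointwise_bound:
  "G \<subseteq> P \<Longrightarrow> finite G \<Longrightarrow> \<exists>h\<in>P. \<forall>g\<in>G. \<forall>a\<in>A. g a \<in> underS \<mu> (h a)"
  by (rule pointwise_bound)
    (simp_all add: ordLess_imp_ordLeq[OF finite_card_of_ordLess[OF _ Cinfinite_cardSuc_A]])

lemma not_le_mod_iff:
  assumes "f \<in> P" "g \<in> P"
  shows "\<not> le_mod \<mu> A J f g \<longleftrightarrow> {a \<in> A. g a \<in> underS \<mu> (f a)} \<notin> J"
proof -
  have "{a \<in> A. f a \<notin> under \<mu> (g a)} = {a \<in> A. g a \<in> underS \<mu> (f a)}"
    using assms P_Field notin_under_iff[OF wo] by blast
  then show ?thesis unfolding le_mod_def by simp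
qed

lemma le_mod_pointwise:
  assumes "ideal_on A J" "\<And>a. a \<in> A \<Longrightarrow> f a \<in> under \<mu> (g a)"
  shows "le_mod \<mu> A J f g"
proof -
  have eq: "{a \<in> A. f a \<notin> under \<mu> (g a)} = {}" using assms(2) by blast
  show ?thesis unfolding le_mod_def eq by (rule ideal_onD(4)[OF assms(1)])
qed

lemma le_mod_trans:
  assumes J: "ideal_on A J" and "le_mod \<mu> A J f g" "le_mod \<mu> A J g h"
  shows "le_mod \<mu> A J f h"
proof -
  have "{a \<in> A. f a \<notin> under \<mu> (h a)} \<subseteq> {a \<in> A. f a \<notin> under \<mu> (g a)} \<union> {a \<in> A. g a \<notin> under \<mu> (h a)}"
    using under_trans[OF wo] by blast
  then show ?thesis using assms ideal_onD(1,2)[OF J] unfolding le_mod_def by meson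
qed

lemma less_mod_imp_le_mod:
  assumes J: "ideal_on A J" and "less_mod \<mu> A J f g"
  shows "le_mod \<mu> A J f g"
proof -
  have "{a \<in> A. f a \<notin> under \<mu> (g a)} \<subseteq> {a \<in> A. f a \<notin> underS \<mu> (g a)}"
    using underS_imp_under[of _ \<mu>] by blast
  then show ?thesis using assms ideal_onD(1)[OF J] unfolding le_mod_def less_mod_def by meson
qed

lemma less_mod_le_mod_absurd:
  assumes J: "ideal_on A J" and fg: "f \<in> P" "g \<in> P" and "less_mod \<mu> A J f g" "le_mod \<mu> A J g f"
  shows False
proof -
  have "A \<subseteq> {a \<in> A. f a \<notin> underS \<mu> (g a)} \<union> {a \<in> A. g a \<notin> under \<mu> (f a)}"
    using fg P_Field notin_under_iff[OF wo] by blast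
  then show False using assms ideal_onD(1-3)[OF J] unfolding le_mod_def less_mod_def by meson
qed

lemma le_mod_mono: "J \<subseteq> J' \<Longrightarrow> le_mod \<mu> A J f g \<Longrightarrow> le_mod \<mu> A J' f g"
  unfolding le_mod_def by blast

lemma less_mod_mono: "J \<subseteq> J' \<Longrightarrow> less_mod \<mu> A J f g \<Longrightarrow> less_mod \<mu> A J' f g"
  unfolding less_mod_def by blast

lemma bounded_mod_mono: "J \<subseteq> J' \<Longrightarrow> bounded_mod J F \<Longrightarrow> bounded_mod J' F"
  unfolding bounded_mod_def using le_mod_mono by blast

lemma ideal_on_Inter:
  assumes "\<J> \<noteq> {}" "\<And>J. J \<in> \<J> \<Longrightarrow> ideal_on A J"
  shows "ideal_on A (\<Inter>\<J>)"
proof -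
  obtain J where "J \<in> \<J>" using assms(1) by blast
  then have "\<Inter>\<J> \<subseteq> Pow A" "A \<notin> \<Inter>\<J>"
    using assms(2)[of J] ideal_onD(3,5)[of A J] by auto
  moreover have "{} \<in> \<Inter>\<J>" using ideal_onD(4)[OF assms(2)] by auto
  moreover have "Y \<in> \<Inter>\<J>" if "X \<in> \<Inter>\<J>" "Y \<subseteq> X" for X Y
    using that ideal_onD(1)[OF assms(2)] by auto
  moreover have "X \<union> Y \<in> \<Inter>\<J>" if "X \<in> \<Inter>\<J>" "Y \<in> \<Inter>\<J>" for X Y
    using that ideal_onD(2)[OF assms(2)] by auto
  ultimately show ?thesis unfolding ideal_on_def by (intro conjI ballI allI impI) simp_all
qed

section \<open>Directedness modulo intersections of ideals\<close>

text \<open>At stage \<open>i\<close> the fewer than \<delta> earlier functions have a bound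
  \<open>b\<close> modulo \<open>I\<close>; a function everywhere above \<open>b\<close> and
  \<open>u i\<close> makes the increase strict.\<close>

lemma increasing_above:
  assumes I: "ideal_on A I" and \<delta>: "Card_order \<delta>" and dir: "directed_mod I \<delta>"
    and u: "\<And>i. i \<in> Field \<delta> \<Longrightarrow> u i \<in> P"
  shows "\<exists>f. \<forall>i\<in>Field \<delta>. f i \<in> P \<and> (\<forall>a\<in>A. u i a \<in> under \<mu> (f i a)) \<and>
           (\<forall>j\<in>underS \<delta> i. less_mod \<mu> A I (f j) (f i))"
proof (rule transfinite_choice[where Q = "\<lambda>i f y. y \<in> P \<and> (\<forall>a\<in>A. u i a \<in> under \<mu> (y a)) \<and>
           (\<forall>j\<in>underS \<delta> i. less_mod \<mu> A I (f j) y)"])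
  show "Well_order \<delta>" using \<delta> Card_order_Well_order by blast
  fix i f assume i: "i \<in> Field \<delta>"
    and IH: "\<And>j. j \<in> underS \<delta> i \<Longrightarrow> f j \<in> P \<and> (\<forall>a\<in>A. u j a \<in> under \<mu> (f j a)) \<and>
           (\<forall>k\<in>underS \<delta> j. less_mod \<mu> A I (f k) (f j))"
  have "|f ` underS \<delta> i| <o \<delta>"
    using card_of_image card_of_underS[OF \<delta> i] ordLeq_ordLess_trans by blast
  then have "bounded_mod I (f ` underS \<delta> i)" using dir IH unfolding directed_mod_def by blast
  then obtain b where b: "b \<in> P" "\<And>j. j \<in> underS \<delta> i \<Longrightarrow> le_mod \<mu> A I (f j) b"
    unfolding bounded_mod_def by blast
  obtain h where h: "h \<in> P" "\<And>a. a \<in> A \<Longrightarrow> b a \<in> underS \<mu> (h a) \<and> u i a \<in> underS \<mu> (h a)"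
    using finite_pointwise_bound[of "{b, u i}"] b(1) u[OF i] by auto
  have "less_mod \<mu> A I (f j) h" if "j \<in> underS \<delta> i" for j
  proof -
    have "{a \<in> A. f j a \<notin> underS \<mu> (h a)} \<subseteq> {a \<in> A. f j a \<notin> under \<mu> (b a)}"
      using under_underS_trans[OF wo] h(2) by blast
    then show ?thesis
      using b(2)[OF that] ideal_onD(1)[OF I] unfolding le_mod_def less_mod_def by meson
  qed
  then show "\<exists>y. y \<in> P \<and> (\<forall>a\<in>A. u i a \<in> under \<mu> (y a)) \<and> (\<forall>j\<in>underS \<delta> i. less_mod \<mu> A I (f j) y)"
    using h underS_imp_under[of _ \<mu>] by blast
qed auto

lemma card_image_cardSuc: "|g ` Field (cardSuc |A| )| \<le>o cardSuc |A|"
  by (rule ordLeq_ordIso_trans[OF card_of_image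
        card_of_Field_ordIso[OF cardSuc_Card_order[OF card_of_Card_order]]])

text \<open>
  Both arguments below run for \<open>|A|\<^sup>+\<close> steps, each of which would single out a new element of \<open>A\<close>.
\<close>

lemma no_long_injection:
  assumes "\<And>i. i \<in> Field (cardSuc |A| ) \<Longrightarrow> x i \<in> A"
    and "\<And>i j. i \<in> underS (cardSuc |A| ) j \<Longrightarrow> x i \<noteq> x j"
  shows False
proof -
  let ?w = "cardSuc |A|"
  have w: "Card_order ?w" using Cinfinite_cardSuc_A by blast
  have "inj_on x (Field ?w)"
  proof (rule inj_onI, rule ccontr)
    fix i j assume "i \<in> Field ?w" "j \<in> Field ?w" "x i = x j" "i \<noteq> j"
    then show False
      using underS_total[OF Card_order_Well_order[OF w]] assms(2)[of i j] assms(2)[of j i] by auto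
  qed
  then have "|Field ?w| \<le>o |A|" using assms(1) card_of_ordLeqI by blast
  moreover have "|A| <o |Field ?w|"
    using cardSuc_greater[OF card_of_Card_order, of A] card_of_Field_ordIso[OF w]
      ordIso_symmetric ordLess_ordIso_trans by blast
  ultimately show False using not_ordLess_ordLeq by blast
qed

text \<open>Meant for an unbounded \<open>F\<close> of least size. At most \<open>|A|^+\<close>
  functions would be bounded pointwise. If a cofinal part \<open>K\<close> of the well-order
  \<open>|F|\<close> were smaller than \<open>F\<close>, the initial segments given by
  \<open>K\<close> would have bounds, and these would have a common bound.\<close>

lemma minimal_unbounded:
  assumes I: "ideal_on A I" and F: "F \<subseteq> P" "\<not> bounded_mod I F" and dir: "directed_mod I |F|"
  shows "regular_cardinal |F|" "cardSuc |A| <o |F|"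
proof -
  show w: "cardSuc |A| <o |F|"
  proof (rule ccontr)
    assume "\<not> cardSuc |A| <o |F|"
    then have "|F| \<le>o cardSuc |A|"
      using ordLess_or_ordLeq[OF cardSuc_Well_order[OF card_of_Card_order] card_of_Well_order] by blast
    then obtain h where "h \<in> P" "\<forall>g\<in>F. \<forall>a\<in>A. g a \<in> underS \<mu> (h a)"
      using pointwise_bound F(1) by blast
    then have "bounded_mod I F"
      unfolding bounded_mod_def using le_mod_pointwise[OF I] underS_imp_under[of _ \<mu>] by blast
    then show False using F(2) by blast
  qed
  have inf': "cinfinite |F|"
    using cinfinite_mono[OF ordLess_imp_ordLeq[OF w]] Cinfinite_cardSuc_A by blast
  have "|K| =o |F|" if K: "K \<subseteq> F" "cofinal K |F|" for K
  proof (rule ccontr)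
    assume "\<not> |K| =o |F|"
    then have K': "|K| <o |F|" using card_of_mono1[OF K(1)] ordLeq_iff_ordLess_or_ordIso by blast
    have "bounded_mod I (underS |F| k)" if k: "k \<in> K" for k
    proof -
      have "k \<in> Field |F|" using k K(1) by (auto simp: Field_card_of)
      then have "|underS |F| k| <o |F|" by (rule card_of_underS[OF card_of_Card_order])
      moreover have "underS |F| k \<subseteq> P"
        using F(1) underS_in_Field[of _ "|F|" k] unfolding Field_card_of by blast
      ultimately show ?thesis using dir unfolding directed_mod_def by blast
    qed
    then obtain b where b: "\<And>k. k \<in> K \<Longrightarrow> b k \<in> P \<and> (\<forall>f\<in>underS |F| k. le_mod \<mu> A I f (b k))"
      unfolding bounded_mod_def by metis
    have "|b ` K| <o |F|" using card_of_image K' ordLeq_ordLess_trans by blast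
    then have "bounded_mod I (b ` K)" using dir b unfolding directed_mod_def by blast
    then obtain h where h: "h \<in> P" "\<And>k. k \<in> K \<Longrightarrow> le_mod \<mu> A I (b k) h"
      unfolding bounded_mod_def by blast
    have "le_mod \<mu> A I f h" if f: "f \<in> F" for f
    proof -
      obtain k where "k \<in> K" "f \<in> underS |F| k"
        using K(2) f unfolding cofinal_def underS_def Field_card_of by blast
      then show ?thesis using b h(2) le_mod_trans[OF I] by blast
    qed
    then show False using F(2) h(1) unfolding bounded_mod_def by blast
  qed
  then show "regular_cardinal |F|"
    unfolding regular_cardinal_def regularCard_def Field_card_of
    using inf' card_of_Card_order by (auto simp: Field_card_of)
qed

text \<open>Take an unbounded \<open>F\<close> of least size and an increasing sequence
  \<open>f\<close> above it. A candidate bound \<open>g\<close> fails modulo some \<open>J\<close>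
  of the family, while some \<open>G g\<close> bounds \<open>f\<close> modulo that same
  \<open>J\<close>. Iterating \<open>G\<close> along \<open>|A|^+\<close> squeezes one function
  \<open>f b\<close> between \<open>g i\<close> and \<open>G (g i)\<close> at a point
  \<open>x i\<close>, and these points are distinct.\<close>

lemma directed_mod_Inter:
  assumes ne: "\<J> \<noteq> {}" and ideal: "\<And>J. J \<in> \<J> \<Longrightarrow> ideal_on A J"
    and dir: "\<And>J. J \<in> \<J> \<Longrightarrow> directed_mod J \<delta>"
  shows "directed_mod (\<Inter>\<J>) \<delta>"
proof (rule ccontr)
  let ?I = "\<Inter>\<J>" and ?w = "cardSuc |A|"
  have I: "ideal_on A ?I" using ideal_on_Inter ne ideal by blast
  assume "\<not> directed_mod ?I \<delta>"
  then have "card_of ` {F. F \<subseteq> P \<and> \<not> bounded_mod ?I F \<and> |F| <o \<delta>} \<noteq> {}" (is "card_of ` ?C \<noteq> {}")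
    unfolding directed_mod_def by blast
  then have "\<exists>r\<in>card_of ` ?C. \<forall>r'\<in>card_of ` ?C. r \<le>o r'"
    by (rule exists_minim_Card_order) (auto simp: card_of_Card_order card_of_card_order_on Field_card_of)
  then obtain F where F: "F \<subseteq> P" "\<not> bounded_mod ?I F" "|F| <o \<delta>"
    and min: "\<And>F'. F' \<in> ?C \<Longrightarrow> |F| \<le>o |F'|"
    by blast
  have dirF: "directed_mod ?I |F|"
    unfolding directed_mod_def using min F(3) not_ordLess_ordLeq ordLess_transitive by blast
  have reg: "regular_cardinal |F|" and big: "?w <o |F|"
    using minimal_unbounded[OF I F(1,2) dirF] by auto
  \<comment> \<open>The order \<open>|F|\<close> lives on \<open>F\<close>, so an index
    \<open>i\<close> is itself a function, and the sequence to be dominated is the identity.\<close>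
  have "\<exists>f. \<forall>i\<in>Field |F|. f i \<in> P \<and> (\<forall>a\<in>A. i a \<in> under \<mu> (f i a)) \<and>
           (\<forall>j\<in>underS |F| i. less_mod \<mu> A ?I (f j) (f i))"
    by (rule increasing_above[OF I card_of_Card_order dirF]) (use F(1) in \<open>auto simp: Field_card_of\<close>)
  then obtain f where f: "\<And>i. i \<in> F \<Longrightarrow> f i \<in> P" "\<And>i a. i \<in> F \<Longrightarrow> a \<in> A \<Longrightarrow> i a \<in> under \<mu> (f i a)"
    and inc: "\<And>i j. i \<in> F \<Longrightarrow> j \<in> underS |F| i \<Longrightarrow> less_mod \<mu> A ?I (f j) (f i)"
    unfolding Field_card_of by blast
  have fbd: "\<exists>i\<in>F. \<exists>J\<in>\<J>. \<exists>h\<in>P. \<not> le_mod \<mu> A J (f i) g \<and> (\<forall>j\<in>F. le_mod \<mu> A J (f j) h)"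
    if g: "g \<in> P" for g
  proof -
    obtain i where i: "i \<in> F" "\<not> le_mod \<mu> A ?I i g"
      using F(2) g unfolding bounded_mod_def by blast
    have "\<not> le_mod \<mu> A ?I (f i) g"
      using i(2) le_mod_pointwise[OF I, of i "f i"] f(2)[OF i(1)] le_mod_trans[OF I] by blast
    then obtain J where J: "J \<in> \<J>" "\<not> le_mod \<mu> A J (f i) g" unfolding le_mod_def by blast
    have "|f ` F| <o \<delta>" using card_of_image F(3) ordLeq_ordLess_trans by blast
    then have "bounded_mod J (f ` F)" using dir[OF J(1)] f(1) unfolding directed_mod_def by blast
    then show ?thesis using i(1) J unfolding bounded_mod_def by blast
  qed
  then obtain \<beta> JJ G where G: "\<And>g. g \<in> P \<Longrightarrow> \<beta> g \<in> F \<and> JJ g \<in> \<J> \<and> G g \<in> P \<and>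
      \<not> le_mod \<mu> A (JJ g) (f (\<beta> g)) g \<and> (\<forall>j\<in>F. le_mod \<mu> A (JJ g) (f j) (G g))"
    by metis
  \<comment> \<open>Later functions lie above \<open>G (g j)\<close> at every point: the ideal
    \<open>JJ (g j)\<close> varies with \<open>j\<close>, so a comparison modulo one ideal would not
    survive.\<close>
  have "\<exists>g. \<forall>i\<in>Field ?w. g i \<in> P \<and> (\<forall>j\<in>underS ?w i. \<forall>a\<in>A. G (g j) a \<in> under \<mu> (g i a))"
  proof (rule transfinite_choice[where Q = "\<lambda>i g y. y \<in> P \<and> (\<forall>j\<in>underS ?w i. \<forall>a\<in>A. G (g j) a \<in> under \<mu> (y a))"])
    show "Well_order ?w" by (rule cardSuc_Well_order[OF card_of_Card_order])
    fix i g assume i: "i \<in> Field ?w"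
      and IH: "\<And>j. j \<in> underS ?w i \<Longrightarrow> g j \<in> P \<and> (\<forall>k\<in>underS ?w j. \<forall>a\<in>A. G (g k) a \<in> under \<mu> (g j a))"
    have "|(\<lambda>j. G (g j)) ` underS ?w i| \<le>o ?w"
      using card_of_image card_of_underS[OF cardSuc_Card_order[OF card_of_Card_order] i]
        ordLeq_ordLess_trans ordLess_imp_ordLeq by blast
    moreover have "(\<lambda>j. G (g j)) ` underS ?w i \<subseteq> P" using IH G by blast
    ultimately obtain h where "h \<in> P" "\<forall>g\<in>(\<lambda>j. G (g j)) ` underS ?w i. \<forall>a\<in>A. g a \<in> underS \<mu> (h a)"
      using pointwise_bound by meson
    then show "\<exists>y. y \<in> P \<and> (\<forall>j\<in>underS ?w i. \<forall>a\<in>A. G (g j) a \<in> under \<mu> (y a))"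
      using underS_imp_under[of _ \<mu>] by blast
  qed auto
  then obtain g where g: "\<And>i. i \<in> Field ?w \<Longrightarrow> g i \<in> P"
    and gG: "\<And>i j a. i \<in> Field ?w \<Longrightarrow> j \<in> underS ?w i \<Longrightarrow> a \<in> A \<Longrightarrow> G (g j) a \<in> under \<mu> (g i a)"
    by blast
  have "|(\<lambda>i. \<beta> (g i)) ` Field ?w| <o |F|"
    by (rule ordLeq_ordLess_trans[OF card_image_cardSuc big])
  moreover have "(\<lambda>i. \<beta> (g i)) ` Field ?w \<subseteq> Field |F|" using g G by (auto simp: Field_card_of)
  ultimately obtain b where b: "b \<in> F" "\<And>i. i \<in> Field ?w \<Longrightarrow> \<beta> (g i) \<in> underS |F| b"
    using regular_cardinal_bound[OF reg, of "(\<lambda>i. \<beta> (g i)) ` Field ?w"] unfolding Field_card_of by blast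
  \<comment> \<open>Without such a point \<open>f b\<close> would be at most \<open>g i\<close>
    modulo \<open>JJ (g i)\<close>, and so would the earlier term \<open>f (\<beta> (g i))\<close>,
    against the choice of \<beta>.\<close>
  have "\<exists>x\<in>A. g i x \<in> underS \<mu> (f b x) \<and> f b x \<in> under \<mu> (G (g i) x)" if i: "i \<in> Field ?w" for i
  proof (rule ccontr)
    assume "\<not> ?thesis"
    then have sub: "{x\<in>A. g i x \<in> underS \<mu> (f b x)} \<subseteq> {x\<in>A. f b x \<notin> under \<mu> (G (g i) x)}" by blast
    let ?J = "JJ (g i)"
    have J: "?J \<in> \<J>" "ideal_on A ?J" using G[OF g[OF i]] ideal by auto
    have "{x\<in>A. f b x \<notin> under \<mu> (G (g i) x)} \<in> ?J"
      using G[OF g[OF i]] b(1) unfolding le_mod_def by blast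
    then have "{x\<in>A. g i x \<in> underS \<mu> (f b x)} \<in> ?J" using sub ideal_onD(1)[OF J(2)] by blast
    then have "le_mod \<mu> A ?J (f b) (g i)" using not_le_mod_iff f(1) b(1) g i by blast
    moreover have "le_mod \<mu> A ?J (f (\<beta> (g i))) (f b)"
      using less_mod_imp_le_mod[OF J(2) less_mod_mono[OF _ inc[OF b]]] i J(1) by blast
    ultimately show False using G[OF g[OF i]] le_mod_trans[OF J(2)] by blast
  qed
  then obtain x where x: "\<And>i. i \<in> Field ?w \<Longrightarrow> x i \<in> A \<and> g i (x i) \<in> underS \<mu> (f b (x i)) \<and>
      f b (x i) \<in> under \<mu> (G (g i) (x i))"
    by metis
  show False
  proof (rule no_long_injection)
    show "x i \<in> A" if "i \<in> Field ?w" for i using x that by blast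
    fix i j assume ij: "i \<in> underS ?w j"
    then have F': "i \<in> Field ?w" "j \<in> Field ?w" using underS_in_Field by metis+
    show "x i \<noteq> x j"
    proof
      assume eq: "x i = x j"
      \<comment> \<open>At a common point \<open>f b\<close> is at most \<open>G (g i)\<close>,
        hence at most the later \<open>g j\<close>; but \<open>x j\<close> was chosen with
        \<open>g j\<close> below \<open>f b\<close>.\<close>
      have "f b (x j) \<in> under \<mu> (g j (x j))"
        using under_trans[OF wo] x[OF F'(1)] gG[OF F'(2) ij] x[OF F'(2)] eq by metis
      then show False using x[OF F'(2)] under_underS_trans[OF wo] underS_irrefl by metis
    qed
  qed
qed

section \<open>Universal sequences\<close>

text \<open>Otherwise each increasing \<open>f\<close> has a bound \<open>H f\<close> modulo some
  \<open>JJ f\<close>, and some increasing \<open>E f\<close> is unbounded modulo that ideal. Build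
  \<open>|A|^+\<close> sequences, each \<open>F i\<close> everywhere above all earlier
  \<open>E (F j)\<close>, and let \<open>h\<close> exceed all \<open>H (F i)\<close>. For a suitable
  index \<open>b\<close> there are points \<open>x i\<close> where \<open>F i b\<close> is at most
  \<open>h\<close> but \<open>E (F i) b\<close> is above it; these points are distinct.\<close>

lemma universal_sequence:
  fixes \<delta> :: "'b rel"
  assumes I: "ideal_on A I" and \<delta>: "regular_cardinal \<delta>" "cardSuc |A| <o \<delta>" and dir: "directed_mod I \<delta>"
    and ideal: "\<And>J. J \<in> \<J> \<Longrightarrow> ideal_on A J \<and> I \<subseteq> J"
    and unb: "\<And>J. J \<in> \<J> \<Longrightarrow> \<exists>e :: 'b \<Rightarrow> _. e ` Field \<delta> \<subseteq> P \<and> \<not> bounded_mod J (e ` Field \<delta>)"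
  shows "\<exists>f. (\<forall>i\<in>Field \<delta>. f i \<in> P \<and> (\<forall>j\<in>underS \<delta> i. less_mod \<mu> A I (f j) (f i))) \<and>
           (\<forall>J\<in>\<J>. \<not> bounded_mod J (f ` Field \<delta>))"
proof (rule ccontr)
  let ?w = "cardSuc |A|"
  define inc where "inc f \<longleftrightarrow> (\<forall>i\<in>Field \<delta>. f i \<in> P \<and> (\<forall>j\<in>underS \<delta> i. less_mod \<mu> A I (f j) (f i)))"
    for f :: "'b \<Rightarrow> 'a \<Rightarrow> 'a"
  assume "\<not> ?thesis"
  then have bd: "\<exists>J\<in>\<J>. bounded_mod J (f ` Field \<delta>)" if "inc f" for f
    using that unfolding inc_def by blast
  have C\<delta>: "Card_order \<delta>" by (rule regular_cardinal_Card_order[OF \<delta>(1)])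
  have "\<exists>J\<in>\<J>. \<exists>h\<in>P. \<exists>e. inc e \<and> (\<forall>i\<in>Field \<delta>. le_mod \<mu> A J (f i) h) \<and> \<not> bounded_mod J (e ` Field \<delta>)"
    if f: "inc f" for f
  proof -
    obtain J h where J: "J \<in> \<J>" and h: "h \<in> P" "\<forall>i\<in>Field \<delta>. le_mod \<mu> A J (f i) h"
      using bd[OF f] unfolding bounded_mod_def by blast
    obtain u :: "'b \<Rightarrow> 'a \<Rightarrow> 'a" where u: "u ` Field \<delta> \<subseteq> P" "\<not> bounded_mod J (u ` Field \<delta>)"
      using unb[OF J] by blast
    obtain e where e: "\<forall>i\<in>Field \<delta>. e i \<in> P \<and> (\<forall>a\<in>A. u i a \<in> under \<mu> (e i a)) \<and>
           (\<forall>j\<in>underS \<delta> i. less_mod \<mu> A I (e j) (e i))"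
      using increasing_above[OF I C\<delta> dir, of u] u(1) by blast
    have J': "ideal_on A J" using ideal J by blast
    have "\<not> bounded_mod J (e ` Field \<delta>)"
    proof
      assume "bounded_mod J (e ` Field \<delta>)"
      then obtain k where k: "k \<in> P" "\<And>i. i \<in> Field \<delta> \<Longrightarrow> le_mod \<mu> A J (e i) k"
        unfolding bounded_mod_def by blast
      have "le_mod \<mu> A J (u i) k" if "i \<in> Field \<delta>" for i
        using le_mod_trans[OF J' le_mod_pointwise[OF J'] k(2)[OF that]] e that by blast
      then show False using u(2) k(1) unfolding bounded_mod_def by blast
    qed
    moreover have "inc e" using e unfolding inc_def by blast
    ultimately show ?thesis using J h by blast
  qed
  then obtain JJ H E where JHE: "\<And>f. inc f \<Longrightarrow> JJ f \<in> \<J> \<and> H f \<in> P \<and> inc (E f) \<and>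
      (\<forall>i\<in>Field \<delta>. le_mod \<mu> A (JJ f) (f i) (H f)) \<and> \<not> bounded_mod (JJ f) (E f ` Field \<delta>)"
    by metis
  have "\<exists>F. \<forall>i\<in>Field ?w. inc (F i) \<and>
     (\<forall>j\<in>underS ?w i. \<forall>\<alpha>\<in>Field \<delta>. \<forall>a\<in>A. E (F j) \<alpha> a \<in> under \<mu> (F i \<alpha> a))"
  proof (rule transfinite_choice[where Q = "\<lambda>i F y. inc y \<and>
     (\<forall>j\<in>underS ?w i. \<forall>\<alpha>\<in>Field \<delta>. \<forall>a\<in>A. E (F j) \<alpha> a \<in> under \<mu> (y \<alpha> a))"])
    show "Well_order ?w" by (rule cardSuc_Well_order[OF card_of_Card_order])
    fix i F assume i: "i \<in> Field ?w" and IH: "\<And>j. j \<in> underS ?w i \<Longrightarrow> inc (F j) \<and>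
        (\<forall>k\<in>underS ?w j. \<forall>\<alpha>\<in>Field \<delta>. \<forall>a\<in>A. E (F k) \<alpha> a \<in> under \<mu> (F j \<alpha> a))"
    have "\<exists>h\<in>P. \<forall>j\<in>underS ?w i. \<forall>a\<in>A. E (F j) \<alpha> a \<in> underS \<mu> (h a)" if \<alpha>: "\<alpha> \<in> Field \<delta>" for \<alpha>
    proof -
      have "|(\<lambda>j. E (F j) \<alpha>) ` underS ?w i| \<le>o ?w"
        using card_of_image card_of_underS[OF cardSuc_Card_order[OF card_of_Card_order] i]
          ordLeq_ordLess_trans ordLess_imp_ordLeq by blast
      moreover have "(\<lambda>j. E (F j) \<alpha>) ` underS ?w i \<subseteq> P" using IH JHE \<alpha> unfolding inc_def by blast
      ultimately show ?thesis using pointwise_bound[of "(\<lambda>j. E (F j) \<alpha>) ` underS ?w i"] by blast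
    qed
    then obtain u where u: "\<And>\<alpha>. \<alpha> \<in> Field \<delta> \<Longrightarrow> u \<alpha> \<in> P \<and>
        (\<forall>j\<in>underS ?w i. \<forall>a\<in>A. E (F j) \<alpha> a \<in> underS \<mu> (u \<alpha> a))"
      by metis
    obtain f where f: "\<forall>i\<in>Field \<delta>. f i \<in> P \<and> (\<forall>a\<in>A. u i a \<in> under \<mu> (f i a)) \<and>
           (\<forall>j\<in>underS \<delta> i. less_mod \<mu> A I (f j) (f i))"
      using increasing_above[OF I C\<delta> dir, of u] u by blast
    have "inc f" using f unfolding inc_def by blast
    moreover have "E (F j) \<alpha> a \<in> under \<mu> (f \<alpha> a)"
      if "j \<in> underS ?w i" "\<alpha> \<in> Field \<delta>" "a \<in> A" for j \<alpha> a
      using u f that under_trans[OF wo underS_imp_under[of _ \<mu>]] by blast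
    ultimately show "\<exists>y. inc y \<and>
        (\<forall>j\<in>underS ?w i. \<forall>\<alpha>\<in>Field \<delta>. \<forall>a\<in>A. E (F j) \<alpha> a \<in> under \<mu> (y \<alpha> a))" by blast
  qed auto
  then obtain F where F: "\<And>i. i \<in> Field ?w \<Longrightarrow> inc (F i)"
    and FE: "\<And>i j \<alpha> a. i \<in> Field ?w \<Longrightarrow> j \<in> underS ?w i \<Longrightarrow> \<alpha> \<in> Field \<delta> \<Longrightarrow> a \<in> A \<Longrightarrow>
      E (F j) \<alpha> a \<in> under \<mu> (F i \<alpha> a)"
    by blast
  note JF = JHE[OF F]
  have "(\<lambda>i. H (F i)) ` Field ?w \<subseteq> P" using JF by blast
  then obtain h where h: "h \<in> P" and hH: "\<And>i a. i \<in> Field ?w \<Longrightarrow> a \<in> A \<Longrightarrow> H (F i) a \<in> underS \<mu> (h a)"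
    using pointwise_bound[OF _ card_image_cardSuc, of "\<lambda>i. H (F i)"] by blast
  have "\<exists>\<alpha>\<in>Field \<delta>. \<not> le_mod \<mu> A (JJ (F i)) (E (F i) \<alpha>) h" if "i \<in> Field ?w" for i
    using JF[OF that] h unfolding bounded_mod_def by blast
  then obtain \<alpha> where \<alpha>: "\<And>i. i \<in> Field ?w \<Longrightarrow> \<alpha> i \<in> Field \<delta> \<and> \<not> le_mod \<mu> A (JJ (F i)) (E (F i) (\<alpha> i)) h"
    by metis
  have "|\<alpha> ` Field ?w| <o \<delta>" using card_image_cardSuc \<delta>(2) ordLeq_ordLess_trans by blast
  then obtain b where b: "b \<in> Field \<delta>" "\<And>i. i \<in> Field ?w \<Longrightarrow> \<alpha> i \<in> underS \<delta> b"
    using regular_cardinal_bound[OF \<delta>(1), of "\<alpha> ` Field ?w"] \<alpha> by blast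
  \<comment> \<open>Modulo \<open>JJ (F i)\<close>, the function \<open>F i b\<close> is at most
    \<open>H (F i)\<close> and thus \<open>h\<close>, whereas \<open>E (F i) b\<close>, which lies
    past index \<open>\<alpha> i\<close>, is not; so some point shows both.\<close>
  have "\<exists>x\<in>A. h x \<in> underS \<mu> (E (F i) b x) \<and> F i b x \<in> under \<mu> (h x)" if i: "i \<in> Field ?w" for i
  proof (rule ccontr)
    assume "\<not> ?thesis"
    then have sub: "{x\<in>A. h x \<in> underS \<mu> (E (F i) b x)} \<subseteq> {x\<in>A. F i b x \<notin> under \<mu> (h x)}" by blast
    let ?J = "JJ (F i)"
    have J: "?J \<in> \<J>" "ideal_on A ?J" "I \<subseteq> ?J" using JF[OF i] ideal by auto
    have "le_mod \<mu> A ?J (F i b) h"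
      using le_mod_trans[OF J(2), of _ "H (F i)"] le_mod_pointwise[OF J(2), of "H (F i)" h]
        hH[OF i] underS_imp_under[of _ \<mu>] JF[OF i] b(1) by blast
    then have "{x\<in>A. h x \<in> underS \<mu> (E (F i) b x)} \<in> ?J"
      using sub ideal_onD(1)[OF J(2)] unfolding le_mod_def by blast
    then have 1: "le_mod \<mu> A ?J (E (F i) b) h"
      using not_le_mod_iff h JF[OF i] b(1) unfolding inc_def by blast
    have "less_mod \<mu> A I (E (F i) (\<alpha> i)) (E (F i) b)"
      using JF[OF i] b(1) b(2)[OF i] unfolding inc_def by blast
    then have "le_mod \<mu> A ?J (E (F i) (\<alpha> i)) (E (F i) b)"
      using less_mod_imp_le_mod[OF J(2)] less_mod_mono[OF J(3)] by blast
    then show False using 1 \<alpha>[OF i] le_mod_trans[OF J(2)] by blast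
  qed
  then obtain x where x: "\<And>i. i \<in> Field ?w \<Longrightarrow> x i \<in> A \<and> h (x i) \<in> underS \<mu> (E (F i) b (x i)) \<and>
      F i b (x i) \<in> under \<mu> (h (x i))"
    by metis
  show False
  proof (rule no_long_injection)
    show "x i \<in> A" if "i \<in> Field ?w" for i using x that by blast
    fix i j assume ij: "i \<in> underS ?w j"
    then have F': "i \<in> Field ?w" "j \<in> Field ?w" using underS_in_Field by metis+
    show "x i \<noteq> x j"
    proof
      assume eq: "x i = x j"
      have "E (F i) b (x j) \<in> under \<mu> (h (x j))"
        using under_trans[OF wo FE[OF F'(2) ij b(1)]] x[OF F'(2)] by blast
      then show False using x[OF F'(1)] eq under_underS_trans[OF wo] underS_irrefl by metis
    qed
  qed
qed

text \<open>If no term dominates \<open>g\<close>, the sets \<open>X i\<close> where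
  \<open>f i\<close> is below \<open>g\<close> lie outside \<open>J\<close> and decrease modulo
  \<open>J\<close>. Calling a set null when it meets some \<open>X i\<close> in a member of
  \<open>J\<close> gives a proper \<sigma>-complete extension modulo which \<open>g\<close> bounds
  the sequence.\<close>

lemma cofinal_if_unbounded:
  assumes J: "ideal_on A J" "complete_ideal \<sigma> J" and \<delta>: "regular_cardinal \<delta>" "\<sigma> \<le>o \<delta>"
    and f: "\<And>i. i \<in> Field \<delta> \<Longrightarrow> f i \<in> P"
    and inc: "\<And>i j. i \<in> Field \<delta> \<Longrightarrow> j \<in> underS \<delta> i \<Longrightarrow> less_mod \<mu> A J (f j) (f i)"
    and unb: "\<And>J'. ideal_on A J' \<Longrightarrow> complete_ideal \<sigma> J' \<Longrightarrow> J \<subseteq> J' \<Longrightarrow> \<not> bounded_mod J' (f ` Field \<delta>)"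
    and g: "g \<in> P"
  shows "\<exists>i\<in>Field \<delta>. le_mod \<mu> A J g (f i)"
proof (rule ccontr)
  assume contra: "\<not> ?thesis"
  define X where "X i = {a \<in> A. f i a \<in> underS \<mu> (g a)}" for i
  define J' where "J' = {Y. Y \<subseteq> A \<and> (\<exists>i\<in>Field \<delta>. Y \<inter> X i \<in> J)}"
  have X: "X i \<notin> J" if "i \<in> Field \<delta>" for i
    using contra that not_le_mod_iff[OF g f] unfolding X_def by blast
  have mono: "Y \<inter> X i \<in> J" if "i \<in> Field \<delta>" "j \<in> underS \<delta> i" "Y \<inter> X j \<in> J" for i j Y
  proof -
    have "Y \<inter> X i \<subseteq> (Y \<inter> X j) \<union> {a \<in> A. f j a \<notin> underS \<mu> (f i a)}"
      unfolding X_def using under_underS_trans[OF wo underS_imp_under[of _ \<mu>]] by blast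
    moreover have "(Y \<inter> X j) \<union> {a \<in> A. f j a \<notin> underS \<mu> (f i a)} \<in> J"
      using ideal_onD(2)[OF J(1) that(3)] inc[OF that(1,2)] unfolding less_mod_def by blast
    ultimately show ?thesis using ideal_onD(1)[OF J(1)] by blast
  qed
  \<comment> \<open>An index past all \<open>i Y\<close> serves every member of \<open>S\<close> at
    once. The closure property \<open>U\<close> of \<open>J\<close> is a premise so that one
    argument covers finite unions and unions of fewer than \<sigma> sets.\<close>
  have complete: "\<Union>S \<in> J'" if S: "S \<subseteq> J'" "|S| <o \<delta>" and U: "\<And>S'. |S'| \<le>o |S| \<Longrightarrow> S' \<subseteq> J \<Longrightarrow> \<Union>S' \<in> J" for S
  proof -
    have "\<forall>Y\<in>S. \<exists>i\<in>Field \<delta>. Y \<subseteq> A \<and> Y \<inter> X i \<in> J" using S(1) unfolding J'_def by blast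
    then obtain i where i: "\<And>Y. Y \<in> S \<Longrightarrow> i Y \<in> Field \<delta> \<and> Y \<subseteq> A \<and> Y \<inter> X (i Y) \<in> J" by metis
    have "|i ` S| <o \<delta>" using card_of_image S(2) ordLeq_ordLess_trans by blast
    then obtain b where b: "b \<in> Field \<delta>" "i ` S \<subseteq> underS \<delta> b"
      using regular_cardinal_bound[OF \<delta>(1), of "i ` S"] i by blast
    have "(\<lambda>Y. Y \<inter> X b) ` S \<subseteq> J" using mono[OF b(1)] b(2) i by blast
    then have U': "\<Union>((\<lambda>Y. Y \<inter> X b) ` S) \<in> J" by (rule U[OF card_of_image])
    have eq: "\<Union>S \<inter> X b = \<Union>((\<lambda>Y. Y \<inter> X b) ` S)" by blast
    have "\<Union>S \<inter> X b \<in> J" unfolding eq by (rule U')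
    moreover have "\<Union>S \<subseteq> A" using i by blast
    ultimately show ?thesis unfolding J'_def using b(1) by blast
  qed
  obtain i0 where i0: "i0 \<in> Field \<delta>"
    using regular_cardinal_Cinfinite[OF \<delta>(1)] unfolding cinfinite_def by fastforce
  have sub: "J \<subseteq> J'"
    using i0 ideal_onD(1,5)[OF J(1)] unfolding J'_def by (auto intro: Int_lower1)
  have "ideal_on A J'" unfolding ideal_on_def
  proof (intro conjI ballI allI impI)
    show "J' \<subseteq> Pow A" unfolding J'_def by blast
    show "{} \<in> J'" using sub ideal_onD(4)[OF J(1)] by blast
    have "A \<inter> X i = X i" for i unfolding X_def by blast
    then show "A \<notin> J'" unfolding J'_def using X by simp
  next
    fix Z Y assume Z: "Z \<in> J'" "Y \<subseteq> Z"
    then obtain i where i: "i \<in> Field \<delta>" "Z \<inter> X i \<in> J" "Z \<subseteq> A" unfolding J'_def by blast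
    have "Y \<inter> X i \<in> J" using ideal_onD(1)[OF J(1) i(2)] Z(2) by blast
    then show "Y \<in> J'" unfolding J'_def using i Z(2) by blast
  next
    fix Z Y assume Z: "Z \<in> J'" "Y \<in> J'"
    have "\<Union>{Z, Y} \<in> J'"
    proof (rule complete)
      show "{Z, Y} \<subseteq> J'" using Z by blast
      show "|{Z, Y}| <o \<delta>" by (rule finite_card_of_ordLess[OF _ regular_cardinal_Cinfinite[OF \<delta>(1)]]) simp
      fix S' :: "'a set set" assume S': "|S'| \<le>o |{Z, Y}|" "S' \<subseteq> J"
      have "finite S'" using card_of_ordLeq_finite[OF S'(1)] by blast
      then show "\<Union>S' \<in> J" using S'(2)
        by (induction S') (auto intro: ideal_onD(4)[OF J(1)] ideal_onD(2)[OF J(1)])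
    qed
    then show "Z \<union> Y \<in> J'" by simp
  qed
  moreover have "complete_ideal \<sigma> J'" unfolding complete_ideal_def
  proof (intro allI impI, elim conjE)
    fix S assume S: "S \<subseteq> J'" "|S| <o \<sigma>"
    show "\<Union>S \<in> J'"
    proof (rule complete[OF S(1) ordLess_ordLeq_trans[OF S(2) \<delta>(2)]])
      fix S' :: "'a set set" assume S': "|S'| \<le>o |S|" "S' \<subseteq> J"
      then show "\<Union>S' \<in> J"
        using J(2) ordLeq_ordLess_trans[OF S'(1) S(2)] unfolding complete_ideal_def by blast
    qed
  qed
  moreover have "bounded_mod J' (f ` Field \<delta>)" unfolding bounded_mod_def
  proof (intro bexI[OF _ g] ballI)
    fix h assume "h \<in> f ` Field \<delta>"
    then obtain i where i: "i \<in> Field \<delta>" "h = f i" by blast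
    have eq: "{a \<in> A. f i a \<notin> under \<mu> (g a)} \<inter> X i = {}"
      unfolding X_def using underS_imp_under[of _ \<mu>] by blast
    have "{a \<in> A. f i a \<notin> under \<mu> (g a)} \<inter> X i \<in> J"
      unfolding eq by (rule ideal_onD(4)[OF J(1)])
    then show "le_mod \<mu> A J' h g" unfolding le_mod_def J'_def i(2) using i(1) by blast
  qed
  ultimately show False using unb sub by blast
qed

section \<open>Consequences of a true cofinality\<close>

lemma is_tcf_directed:
  assumes J: "ideal_on A J" and t: "is_tcf \<mu> A J \<rho>"
  shows "directed_mod J \<rho>"
  unfolding directed_mod_def
proof (intro allI impI, elim conjE)
  fix F assume F: "F \<subseteq> P" "|F| <o \<rho>"
  obtain f where reg: "regular_cardinal \<rho>" and f: "\<And>i. i \<in> Field \<rho> \<Longrightarrow> f i \<in> P"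
    and inc: "\<And>i j. i\<in>Field \<rho> \<Longrightarrow> j\<in>Field \<rho> \<Longrightarrow> i \<in> underS \<rho> j \<Longrightarrow> less_mod \<mu> A J (f i) (f j)"
    and cof: "\<forall>g\<in>P. \<exists>i\<in>Field \<rho>. le_mod \<mu> A J g (f i)"
    using t unfolding is_tcf_def by blast
  obtain i where i: "\<And>g. g \<in> F \<Longrightarrow> i g \<in> Field \<rho> \<and> le_mod \<mu> A J g (f (i g))"
    using cof F(1) by (metis subsetD)
  have "|i ` F| <o \<rho>" using card_of_image F(2) ordLeq_ordLess_trans by blast
  then obtain b where b: "b \<in> Field \<rho>" "i ` F \<subseteq> underS \<rho> b"
    using regular_cardinal_bound[OF reg, of "i ` F"] i by blast
  have "le_mod \<mu> A J g (f b)" if "g \<in> F" for g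
    using le_mod_trans[OF J] less_mod_imp_le_mod[OF J inc[of "i g" b]] i[OF that] b that by blast
  then show "bounded_mod J F" unfolding bounded_mod_def using f[OF b(1)] by blast
qed

text \<open>A bound \<open>h\<close> of a cofinal sequence would bound every function, even some
  \<open>k\<close> strictly above \<open>h\<close>.\<close>

lemma is_tcf_unbounded:
  fixes \<rho> :: "'b rel"
  assumes J: "ideal_on A J" and t: "is_tcf \<mu> A J \<rho>"
  shows "\<exists>e :: 'b \<Rightarrow> _. e ` Field \<rho> \<subseteq> P \<and> \<not> bounded_mod J (e ` Field \<rho>)"
proof -
  obtain f where f: "\<And>i. i \<in> Field \<rho> \<Longrightarrow> f i \<in> P"
    and cof: "\<And>g. g\<in>P \<Longrightarrow> \<exists>i\<in>Field \<rho>. le_mod \<mu> A J g (f i)"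
    using t unfolding is_tcf_def by blast
  have "\<not> bounded_mod J (f ` Field \<rho>)"
  proof
    assume "bounded_mod J (f ` Field \<rho>)"
    then obtain h where h: "h \<in> P" "\<And>i. i \<in> Field \<rho> \<Longrightarrow> le_mod \<mu> A J (f i) h"
      unfolding bounded_mod_def by blast
    obtain k where k: "k \<in> P" "\<And>a. a \<in> A \<Longrightarrow> h a \<in> underS \<mu> (k a)"
      using finite_pointwise_bound[of "{h}"] h(1) by auto
    have "{a \<in> A. h a \<notin> underS \<mu> (k a)} = {}" using k(2) by blast
    then have "less_mod \<mu> A J h k" unfolding less_mod_def using ideal_onD(4)[OF J] by metis
    moreover have "le_mod \<mu> A J k h" using cof[OF k(1)] h(2) le_mod_trans[OF J] by blast
    ultimately show False using less_mod_le_mod_absurd[OF J h(1) k(1)] by blast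
  qed
  then show ?thesis using f by blast
qed

text \<open>A cofinal sequence of length at most \<open>|A|^+\<close> would have a pointwise
  bound.\<close>

lemma is_tcf_large:
  assumes J: "ideal_on A J" and t: "is_tcf \<mu> A J \<rho>"
  shows "cardSuc |A| <o \<rho>"
proof (rule ccontr)
  assume not: "\<not> cardSuc |A| <o \<rho>"
  have \<rho>: "Card_order \<rho>" using t regular_cardinal_Card_order unfolding is_tcf_def by blast
  then have le: "\<rho> \<le>o cardSuc |A|"
    using ordLess_or_ordLeq[OF cardSuc_Well_order[OF card_of_Card_order] Card_order_Well_order] not by blast
  obtain e where e: "e ` Field \<rho> \<subseteq> P" "\<not> bounded_mod J (e ` Field \<rho>)"
    using is_tcf_unbounded[OF J t] by blast
  have "|e ` Field \<rho>| \<le>o cardSuc |A|"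
    using ordLeq_transitive[OF ordLeq_ordIso_trans[OF card_of_image card_of_Field_ordIso[OF \<rho>]] le] .
  from pointwise_bound[OF e(1) this]
  obtain h where h: "h \<in> P" "\<And>g a. g \<in> e ` Field \<rho> \<Longrightarrow> a \<in> A \<Longrightarrow> g a \<in> underS \<mu> (h a)"
    by blast
  have "le_mod \<mu> A J g h" if "g \<in> e ` Field \<rho>" for g
    using le_mod_pointwise[OF J, of g h] underS_imp_under[OF h(2)[OF that]] by blast
  then show False using e(2) h(1) unfolding bounded_mod_def by blast
qed

lemma is_tcf_mono:
  assumes "is_tcf \<mu> A J \<rho>" "J \<subseteq> J'"
  shows "is_tcf \<mu> A J' \<rho>"
proof -
  obtain f where "regular_cardinal \<rho>" "\<forall>i\<in>Field \<rho>. f i \<in> P"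
    "\<forall>i\<in>Field \<rho>. \<forall>j\<in>Field \<rho>. i \<in> underS \<rho> j \<longrightarrow> less_mod \<mu> A J (f i) (f j)"
    "\<forall>g\<in>P. \<exists>i\<in>Field \<rho>. le_mod \<mu> A J g (f i)"
    using assms(1) unfolding is_tcf_def by blast
  then show ?thesis
    using le_mod_mono[OF assms(2)] less_mod_mono[OF assms(2)] unfolding is_tcf_def
    by (intro conjI exI[of _ f]) blast+
qed

section \<open>Universal families and existence of true cofinalities\<close>

text \<open>The intersection of all these ideals is still \<open>w\<close>-directed, so it carries a
  universal sequence. A proper \<sigma>-complete extension of one of them has the same true
  cofinality, so unboundedness over the whole family becomes cofinality for each member.\<close>

lemma universal_family:
  fixes w :: "'b rel" and \<sigma> :: "'s rel"
  assumes \<sigma>: "\<sigma> \<le>o |A|"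
  shows "\<exists>F. F \<subseteq> P \<and> |F| \<le>o |Field w| \<and>
    (\<forall>J. ideal_on A J \<and> complete_ideal \<sigma> J \<and> is_tcf \<mu> A J w \<longrightarrow> (\<forall>g\<in>P. \<exists>f\<in>F. le_mod \<mu> A J g f))"
proof -
  define \<J> where "\<J> = {J. ideal_on A J \<and> complete_ideal \<sigma> J \<and> is_tcf \<mu> A J w}"
  show ?thesis
  proof (cases "\<J> = {}")
    case True
    then show ?thesis unfolding \<J>_def by (intro exI[of _ "{}"]) (auto simp: card_of_empty)
  next
    case False
    have ideal: "ideal_on A J" if "J \<in> \<J>" for J using that unfolding \<J>_def by blast
    have tcf: "is_tcf \<mu> A J w" if "J \<in> \<J>" for J using that unfolding \<J>_def by blast
    obtain J0 where J0: "J0 \<in> \<J>" using False by blast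
    have w: "regular_cardinal w" "cardSuc |A| <o w"
      using tcf[OF J0] is_tcf_large[OF ideal tcf, OF J0 J0] unfolding is_tcf_def by blast+
    have \<sigma>w: "\<sigma> \<le>o w"
      using ordLeq_transitive[OF \<sigma> ordLess_imp_ordLeq[OF ordLess_transitive[OF cardSuc_greater[OF card_of_Card_order] w(2)]]] .
    have "directed_mod (\<Inter>\<J>) w" using directed_mod_Inter[OF False] ideal tcf is_tcf_directed by blast
    moreover have "ideal_on A J \<and> \<Inter>\<J> \<subseteq> J" if "J \<in> \<J>" for J using ideal that by blast
    moreover have "\<exists>e :: 'b \<Rightarrow> _. e ` Field w \<subseteq> P \<and> \<not> bounded_mod J (e ` Field w)" if "J \<in> \<J>" for J
      using is_tcf_unbounded ideal tcf that by blast
    ultimately obtain f where f: "\<And>i. i \<in> Field w \<Longrightarrow> f i \<in> P"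
      and inc: "\<And>i j. i \<in> Field w \<Longrightarrow> j \<in> underS w i \<Longrightarrow> less_mod \<mu> A (\<Inter>\<J>) (f j) (f i)"
      and unb: "\<And>J. J \<in> \<J> \<Longrightarrow> \<not> bounded_mod J (f ` Field w)"
      using universal_sequence[OF ideal_on_Inter[OF False ideal] w, of \<J>] by blast
    have "\<exists>i\<in>Field w. le_mod \<mu> A J g (f i)" if J: "J \<in> \<J>" and g: "g \<in> P" for J g
    proof (rule cofinal_if_unbounded[OF _ _ w(1) \<sigma>w f])
      show "ideal_on A J" "complete_ideal \<sigma> J" "g \<in> P" using J g unfolding \<J>_def by blast+
      show "less_mod \<mu> A J (f j) (f i)" if "i \<in> Field w" "j \<in> underS w i" for i j
        using less_mod_mono[OF _ inc[OF that]] J by blast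
      show "\<not> bounded_mod J' (f ` Field w)"
        if "ideal_on A J'" "complete_ideal \<sigma> J'" "J \<subseteq> J'" for J'
        using unb[of J'] that is_tcf_mono[OF tcf[OF J]] unfolding \<J>_def by blast
    qed
    then have "\<forall>J. ideal_on A J \<and> complete_ideal \<sigma> J \<and> is_tcf \<mu> A J w \<longrightarrow>
        (\<forall>g\<in>P. \<exists>h\<in>f ` Field w. le_mod \<mu> A J g h)"
      unfolding \<J>_def by blast
    then show ?thesis using f card_of_image by (intro exI[of _ "f ` Field w"]) blast
  qed
qed

text \<open>
  A least \<open>|F|\<close> for which \<open>F\<close> is unbounded modulo some extension of \<open>J0\<close> is the true cofinality.
  The set \<open>Y\<close> is chosen so that no extension concentrating on it is \<open>|F|\<^sup>+\<close>-directed; then a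
  universal sequence of length \<open>|F|\<close> exists over it.
\<close>

lemma exists_tcf:
  fixes \<sigma> :: "'s rel"
  assumes J0: "ideal_on A J0" "complete_ideal \<sigma> J0" and \<sigma>: "\<sigma> \<le>o |A|"
  shows "\<exists>J (\<rho> :: 'a set rel). ideal_on A J \<and> complete_ideal \<sigma> J \<and> J0 \<subseteq> J \<and> is_tcf \<mu> A J \<rho>"
proof -
  define \<J>0 where "\<J>0 = {J. ideal_on A J \<and> complete_ideal \<sigma> J \<and> J0 \<subseteq> J}"
  have ideal: "ideal_on A J" if "J \<in> \<J>0" for J using that unfolding \<J>0_def by blast
  let ?C = "{F. F \<subseteq> P \<and> (\<exists>J\<in>\<J>0. \<not> bounded_mod J F)}"
  have J00: "J0 \<in> \<J>0" using J0 unfolding \<J>0_def by blast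
  have "\<not> bounded_mod J0 P"
  proof
    assume "bounded_mod J0 P"
    then obtain h where h: "h \<in> P" "\<And>f. f \<in> P \<Longrightarrow> le_mod \<mu> A J0 f h" unfolding bounded_mod_def by blast
    obtain k where k: "k \<in> P" "\<And>a. a \<in> A \<Longrightarrow> h a \<in> underS \<mu> (k a)"
      using finite_pointwise_bound[of "{h}"] h(1) by auto
    have "{a \<in> A. h a \<notin> underS \<mu> (k a)} = {}" using k(2) by blast
    then have "less_mod \<mu> A J0 h k" unfolding less_mod_def using ideal_onD(4)[OF J0(1)] by metis
    then show False using less_mod_le_mod_absurd[OF J0(1) h(1) k(1)] h(2)[OF k(1)] by blast
  qed
  then have "card_of ` ?C \<noteq> {}" using J00 by blast
  then have "\<exists>r\<in>card_of ` ?C. \<forall>r'\<in>card_of ` ?C. r \<le>o r'"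
    by (rule exists_minim_Card_order) (auto simp: card_of_Card_order card_of_card_order_on Field_card_of)
  then obtain F J1 where F: "F \<subseteq> P" and J1: "J1 \<in> \<J>0" "\<not> bounded_mod J1 F"
    and min: "\<And>F'. F' \<in> ?C \<Longrightarrow> |F| \<le>o |F'|"
    by blast
  have dir: "directed_mod J |F|" if "J \<in> \<J>0" for J
    unfolding directed_mod_def using min that not_ordLess_ordLeq by blast
  have reg: "regular_cardinal |F|" and big: "cardSuc |A| <o |F|"
    using minimal_unbounded[OF ideal[OF J1(1)] F J1(2) dir[OF J1(1)]] by auto
  have \<sigma>F: "\<sigma> \<le>o |F|"
    using ordLeq_transitive[OF \<sigma> ordLess_imp_ordLeq[OF ordLess_transitive[OF cardSuc_greater[OF card_of_Card_order] big]]] .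
  define \<J>1 where "\<J>1 = {J \<in> \<J>0. directed_mod J (cardSuc |F| )}"
  have "\<exists>Y. Y \<subseteq> A \<and> Y \<notin> J1 \<and> (\<forall>J\<in>\<J>1. Y \<in> J)"
  proof (cases "\<J>1 = {}")
    case True
    then show ?thesis using ideal_onD(3)[OF ideal[OF J1(1)]] by blast
  next
    case False
    \<comment> \<open>The intersection of the \<open>|F|^+\<close>-directed ideals is again
      \<open>|F|^+\<close>-directed and hence bounds \<open>F\<close>, which \<open>J1\<close> does
      not; so it has a member outside \<open>J1\<close>.\<close>
    have "directed_mod (\<Inter>\<J>1) (cardSuc |F| )"
      by (rule directed_mod_Inter[OF False]) (auto simp: \<J>1_def ideal)
    then have "bounded_mod (\<Inter>\<J>1) F"
      using F cardSuc_greater[OF card_of_Card_order] unfolding directed_mod_def by blast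
    then have "\<not> \<Inter>\<J>1 \<subseteq> J1" using J1(2) bounded_mod_mono by blast
    moreover have "Y \<subseteq> A" if "Y \<in> \<Inter>\<J>1" for Y
      using that False ideal_onD(5)[OF ideal] unfolding \<J>1_def by blast
    ultimately show ?thesis by blast
  qed
  then obtain Y where Y: "Y \<subseteq> A" "Y \<notin> J1" "\<And>J. J \<in> \<J>1 \<Longrightarrow> Y \<in> J" by blast
  \<comment> \<open>This is the ideal generated by \<open>J1\<close> and \<open>A - Y\<close>. A
    proper extension cannot contain \<open>Y\<close>, so no \<sigma>-complete one is
    \<open>|F|^+\<close>-directed.\<close>
  define J2 where "J2 = {Z. Z \<subseteq> A \<and> Z \<inter> Y \<in> J1}"
  note J1i = ideal[OF J1(1)]
  have J12: "J1 \<subseteq> J2"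
    unfolding J2_def using ideal_onD(1,5)[OF J1i] by (auto intro: Int_lower1)
  have J2: "J2 \<in> \<J>0"
  proof -
    have "ideal_on A J2" unfolding ideal_on_def
    proof (intro conjI ballI allI impI)
      show "J2 \<subseteq> Pow A" unfolding J2_def by blast
      show "{} \<in> J2" using J12 ideal_onD(4)[OF J1i] by blast
      have "A \<inter> Y = Y" using Y(1) by blast
      then show "A \<notin> J2" unfolding J2_def using Y(2) by simp
      fix X X' assume X: "X \<in> J2"
      show "X' \<in> J2" if "X' \<subseteq> X"
      proof -
        have "X' \<inter> Y \<subseteq> X \<inter> Y" using that by blast
        then show ?thesis using X that ideal_onD(1)[OF J1i] unfolding J2_def by blast
      qed
      show "X \<union> X' \<in> J2" if "X' \<in> J2"
        using X that ideal_onD(2)[OF J1i] unfolding J2_def by (simp add: Int_Un_distrib2)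
    qed
    moreover have "complete_ideal \<sigma> J2" unfolding complete_ideal_def
    proof (intro allI impI, elim conjE)
      fix S assume S: "S \<subseteq> J2" "|S| <o \<sigma>"
      have "|(\<lambda>Z. Z \<inter> Y) ` S| <o \<sigma>" using card_of_image S(2) ordLeq_ordLess_trans by blast
      moreover have "(\<lambda>Z. Z \<inter> Y) ` S \<subseteq> J1" using S(1) unfolding J2_def by blast
      ultimately have U: "\<Union>((\<lambda>Z. Z \<inter> Y) ` S) \<in> J1"
        using J1(1) unfolding \<J>0_def complete_ideal_def by blast
      have eq: "\<Union>S \<inter> Y = \<Union>((\<lambda>Z. Z \<inter> Y) ` S)" by blast
      have "\<Union>S \<inter> Y \<in> J1" unfolding eq by (rule U)
      then show "\<Union>S \<in> J2" using S(1) unfolding J2_def by blast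
    qed
    ultimately show ?thesis using J12 J1(1) unfolding \<J>0_def by blast
  qed
  define \<J>2 where "\<J>2 = {J \<in> \<J>0. J2 \<subseteq> J}"
  have unb2: "\<exists>e. e ` Field |F| \<subseteq> P \<and> \<not> bounded_mod J (e ` Field |F| )" if J: "J \<in> \<J>2" for J
  proof -
    have J': "J \<in> \<J>0" "J2 \<subseteq> J" using J unfolding \<J>2_def by auto
    note Ji = ideal[OF J'(1)]
    have eq: "(A - Y) \<inter> Y = {}" by blast
    have "(A - Y) \<inter> Y \<in> J1" unfolding eq by (rule ideal_onD(4)[OF J1i])
    then have "A - Y \<in> J" using J'(2) unfolding J2_def by blast
    then have "Y \<notin> J" using ideal_onD(2,3)[OF Ji] Y(1) by (metis Diff_partition Un_commute)
    then have "J \<notin> \<J>1" using Y(3) by blast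
    then obtain F' where F': "F' \<subseteq> P" "|F'| <o cardSuc |F|" "\<not> bounded_mod J F'"
      using J'(1) unfolding \<J>1_def directed_mod_def by blast
    have "|F'| \<le>o |F|"
      using F'(2) cardSuc_ordLeq_ordLess[OF card_of_Card_order card_of_Card_order] by blast
    \<comment> \<open>Nonemptiness lets \<open>F\<close> be mapped onto \<open>F'\<close>, which
      turns an unbounded set into a sequence of length \<open>|F|\<close>.\<close>
    moreover have "F' \<noteq> {}"
      using F'(3) finite_pointwise_bound[of "{}"] unfolding bounded_mod_def by auto
    ultimately obtain e where "e ` F = F'" using card_of_ordLeq2[of F' F] by blast
    then show ?thesis using F' unfolding Field_card_of by blast
  qed
  have "ideal_on A J \<and> J2 \<subseteq> J" if "J \<in> \<J>2" for J using that ideal unfolding \<J>2_def by blast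
  then obtain f where f: "\<And>i. i \<in> Field |F| \<Longrightarrow> f i \<in> P"
    and inc: "\<And>i j. i \<in> Field |F| \<Longrightarrow> j \<in> underS |F| i \<Longrightarrow> less_mod \<mu> A J2 (f j) (f i)"
    and unb: "\<And>J. J \<in> \<J>2 \<Longrightarrow> \<not> bounded_mod J (f ` Field |F| )"
    using universal_sequence[OF ideal[OF J2] reg big dir[OF J2], of \<J>2] unb2 by blast
  have cof: "\<exists>i\<in>Field |F|. le_mod \<mu> A J2 g (f i)" if g: "g \<in> P" for g
  proof (rule cofinal_if_unbounded[OF ideal[OF J2] _ reg \<sigma>F f inc _ g])
    show "complete_ideal \<sigma> J2" using J2 unfolding \<J>0_def by blast
    show "\<not> bounded_mod J' (f ` Field |F| )"
      if "ideal_on A J'" "complete_ideal \<sigma> J'" "J2 \<subseteq> J'" for J'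
      using unb[of J'] that J2 unfolding \<J>2_def \<J>0_def by blast
  qed
  have t: "is_tcf \<mu> A J2 |F|" unfolding is_tcf_def using reg f inc cof by blast
  have "A \<subseteq> Field \<mu>" using Reg unfolding Reg_below_def by blast
  \<comment> \<open>The cardinal \<open>|F|\<close> lives on functions; the general bound on true
    cofinalities moves it to the type of subsets.\<close>
  then have "|F| \<le>o |UNIV :: 'a set set|" using is_tcf_ordLeq[OF Cinf _ ideal[OF J2] t] by blast
  then obtain X :: "'a set set" where "|F| =o |X|" unfolding internalize_card_of_ordLeq2[of F] by blast
  then have "is_tcf \<mu> A J2 |X|" by (rule is_tcf_ordIso[OF t])
  then show ?thesis using J2 unfolding \<J>0_def by blast
qed

section \<open>Covering a product by few functions\<close>

text \<open>\<open>F\<close> unites universal families for all cardinals up to \<beta>. If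
  \<open>g\<close> and \<open>B\<close> defeat every \<open>S\<close>, the sets that can be handled
  form a proper \<sigma>-complete ideal, and some extension has a true cofinality in the pcf. Its
  universal family contains an \<open>f\<close> above \<open>g\<close> modulo the extension, yet the
  set where \<open>f\<close> is above \<open>g\<close> is null.\<close>

lemma covering_family:
  fixes \<sigma> :: "'s rel" and \<theta> :: "'t rel" and \<kappa> :: "'a set rel"
  assumes \<sigma>: "regular_cardinal \<sigma>" "\<sigma> \<le>o cf \<mu>" "\<sigma> \<le>o |A|" and \<kappa>: "regular_cardinal \<kappa>"
    and cof: "cofinal A \<mu>" and \<beta>: "\<beta> <o \<kappa>" "\<And>\<rho>. \<rho> \<in> pcf_Gamma_star \<theta> \<sigma> \<mu> A \<Longrightarrow> \<rho> \<le>o \<beta>"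
  shows "\<exists>F. F \<subseteq> P \<and> |F| <o \<kappa> \<and> (\<forall>g\<in>P. \<forall>B. B \<subseteq> A \<and> |B| <o \<theta> \<longrightarrow>
    (\<exists>S. S \<subseteq> F \<and> |S| <o \<sigma> \<and> {a \<in> B. \<forall>f\<in>S. f a \<in> underS \<mu> (g a)} \<in> Jbd \<mu> A))"
proof -
  have wk: "Well_order \<kappa>" and ck: "Card_order \<kappa>"
    using regular_cardinal_Well_order regular_cardinal_Card_order \<kappa> by blast+
  obtain x0 where x0: "x0 \<in> Field \<kappa>" "\<beta> =o seg \<kappa> x0" using ordLess_ordIso_seg[OF wk \<beta>(1)] by blast
  \<comment> \<open>One point past \<open>x0\<close>, so that cardinals at most \<beta> become
    proper initial segments of \<open>seg \<kappa> x1\<close>; the points below \<open>x1\<close>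
    then index all of them.\<close>
  obtain x1 where x1: "x1 \<in> Field \<kappa>" "x0 \<in> underS \<kappa> x1"
    using infinite_Card_order_limit[OF ck _ x0(1)] regular_cardinal_Cinfinite[OF \<kappa>]
    unfolding cinfinite_def underS_def by blast
  have "seg (seg \<kappa> x1) x0 <o seg \<kappa> x1"
    using seg_ordLess[OF Well_order_seg[OF wk]] x1(2) Field_seg[OF wk] by blast
  then have \<beta>x1: "\<beta> <o seg \<kappa> x1" using seg_seg[OF wk x1(2)] x0(2) ordIso_ordLess_trans by metis
  have small: "\<exists>x\<in>underS \<kappa> x1. \<rho> =o seg \<kappa> x" if "\<rho> \<in> pcf_Gamma_star \<theta> \<sigma> \<mu> A" for \<rho>
  proof -
    have "\<rho> <o seg \<kappa> x1" using ordLeq_ordLess_trans[OF \<beta>(2)[OF that] \<beta>x1] .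
    then obtain x where "x \<in> Field (seg \<kappa> x1)" "\<rho> =o seg (seg \<kappa> x1) x"
      using ordLess_ordIso_seg[OF Well_order_seg[OF wk]] by blast
    then show ?thesis using Field_seg[OF wk] seg_seg[OF wk] by metis
  qed
  have "\<exists>F. F \<subseteq> P \<and> |F| \<le>o |Field (seg \<kappa> x)| \<and> (\<forall>J. ideal_on A J \<and> complete_ideal \<sigma> J \<and>
      is_tcf \<mu> A J (seg \<kappa> x) \<longrightarrow> (\<forall>g\<in>P. \<exists>f\<in>F. le_mod \<mu> A J g f))" for x
    by (rule universal_family[OF \<sigma>(3)])
  then obtain G where G: "\<And>x. G x \<subseteq> P" "\<And>x. |G x| \<le>o |underS \<kappa> x|"
    "\<And>x J g. ideal_on A J \<Longrightarrow> complete_ideal \<sigma> J \<Longrightarrow> is_tcf \<mu> A J (seg \<kappa> x) \<Longrightarrow> g \<in> P \<Longrightarrow>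
      \<exists>f\<in>G x. le_mod \<mu> A J g f"
    unfolding Field_seg[OF wk] by metis
  define F where "F = (\<Union>x\<in>underS \<kappa> x1. G x)"
  have FP: "F \<subseteq> P" unfolding F_def using G(1) by blast
  have "|G x| <o \<kappa>" if "x \<in> underS \<kappa> x1" for x
    using ordLeq_ordLess_trans[OF G(2) card_of_underS[OF ck]] underS_in_Field[OF that] by blast
  then have F\<kappa>: "|F| <o \<kappa>" unfolding F_def
    by (rule regular_cardinal_UNION[OF \<kappa> card_of_underS[OF ck x1(1)]])
  have cov: "\<exists>S. S \<subseteq> F \<and> |S| <o \<sigma> \<and> {a \<in> B. \<forall>f\<in>S. f a \<in> underS \<mu> (g a)} \<in> Jbd \<mu> A"
    if g: "g \<in> P" and B: "B \<subseteq> A" "|B| <o \<theta>" for g B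
  proof (rule ccontr)
    assume contra: "\<not> ?thesis"
    define E where "E Y S = {a \<in> Y \<inter> B. \<forall>f\<in>S. f a \<in> underS \<mu> (g a)}" for Y S
    \<comment> \<open>A set is null when fewer than \<sigma> members of \<open>F\<close> suffice on
      its part in \<open>B\<close>: outside a bounded set, one of them is at least
      \<open>g\<close>.\<close>
    define J0 where "J0 = {Y. Y \<subseteq> A \<and> (\<exists>S. S \<subseteq> F \<and> |S| <o \<sigma> \<and> E Y S \<in> Jbd \<mu> A)}"
    have J0I: "Y \<in> J0" if "Y \<subseteq> A" "S \<subseteq> F" "|S| <o \<sigma>" "E Y S \<in> Jbd \<mu> A" for Y S
      unfolding J0_def using that by blast
    have J0D: "Y \<subseteq> A \<and> (\<exists>S. S \<subseteq> F \<and> |S| <o \<sigma> \<and> E Y S \<in> Jbd \<mu> A)" if "Y \<in> J0" for Y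
      using that unfolding J0_def by simp
    have fin: "|S| <o \<sigma>" if "finite S" for S :: "('a \<Rightarrow> 'a) set"
      by (rule finite_card_of_ordLess[OF that regular_cardinal_Cinfinite[OF \<sigma>(1)]])
    have down: "Y \<in> Jbd \<mu> A" if "X \<in> Jbd \<mu> A" "Y \<subseteq> X" for X Y
      using that unfolding Jbd_def by blast
    have "Field \<mu> \<noteq> {}" using Cinf unfolding cinfinite_def by auto
    then have empty: "{} \<in> Jbd \<mu> A" using Jbd_iff[OF cof, of "{}"] by blast
    have complete: "\<Union>\<S> \<in> J0" if \<S>: "\<S> \<subseteq> J0" "|\<S>| <o \<sigma>" for \<S>
    proof -
      have "\<exists>S. Y \<subseteq> A \<and> S \<subseteq> F \<and> |S| <o \<sigma> \<and> E Y S \<in> Jbd \<mu> A" if "Y \<in> \<S>" for Y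
        using J0D[OF subsetD[OF \<S>(1) that]] by simp
      then obtain s where s: "\<And>Y. Y \<in> \<S> \<Longrightarrow> Y \<subseteq> A \<and> s Y \<subseteq> F \<and> |s Y| <o \<sigma> \<and> E Y (s Y) \<in> Jbd \<mu> A"
        by metis
      have "|(\<lambda>Y. E Y (s Y)) ` \<S>| <o cf \<mu>"
        by (rule ordLess_ordLeq_trans[OF ordLeq_ordLess_trans[OF card_of_image \<S>(2)] \<sigma>(2)])
      then have "\<Union>((\<lambda>Y. E Y (s Y)) ` \<S>) \<in> Jbd \<mu> A"
        by (rule Jbd_Union[OF Cinf cof, rotated]) (use s in blast)
      moreover have "E (\<Union>\<S>) (\<Union>Y\<in>\<S>. s Y) \<subseteq> \<Union>((\<lambda>Y. E Y (s Y)) ` \<S>)" unfolding E_def by blast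
      ultimately have "E (\<Union>\<S>) (\<Union>Y\<in>\<S>. s Y) \<in> Jbd \<mu> A" by (rule down)
      moreover have "|\<Union>Y\<in>\<S>. s Y| <o \<sigma>"
        by (rule regular_cardinal_UNION[OF \<sigma>(1) \<S>(2)]) (use s in blast)
      moreover have "(\<Union>Y\<in>\<S>. s Y) \<subseteq> F" "\<Union>\<S> \<subseteq> A" using s by blast+
      ultimately show ?thesis using J0I by blast
    qed
    have sub: "Jbd \<mu> A \<subseteq> J0"
    proof
      fix Y assume Y: "Y \<in> Jbd \<mu> A"
      have "E Y {} \<subseteq> Y" unfolding E_def by blast
      then have "E Y {} \<in> Jbd \<mu> A" by (rule down[OF Y])
      then show "Y \<in> J0"
        using J0I[of Y "{}", OF _ _ fin] Y unfolding Jbd_def by simp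
    qed
    have "ideal_on A J0" unfolding ideal_on_def
    proof (intro conjI ballI allI impI)
      show "J0 \<subseteq> Pow A" unfolding J0_def by blast
      show "{} \<in> J0" using sub empty by blast
      have "E A S = {a \<in> B. \<forall>f\<in>S. f a \<in> underS \<mu> (g a)}" for S
        unfolding E_def using B(1) by blast
      then show "A \<notin> J0" using J0D[of A] contra by metis
    next
      fix Z Y assume Z: "Z \<in> J0" "Y \<subseteq> Z"
      then obtain S where S: "Z \<subseteq> A" "S \<subseteq> F" "|S| <o \<sigma>" "E Z S \<in> Jbd \<mu> A" using J0D[OF Z(1)] by blast
      have "E Y S \<subseteq> E Z S" unfolding E_def using Z(2) by blast
      then show "Y \<in> J0" using J0I[of Y S, OF _ S(2,3) down[OF S(4)]] S(1) Z(2) by simp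
    next
      fix Z Y assume Z: "Z \<in> J0" "Y \<in> J0"
      have "\<Union>{Z, Y} \<in> J0"
        by (rule complete) (use Z finite_card_of_ordLess[OF _ regular_cardinal_Cinfinite[OF \<sigma>(1)], of "{Z, Y}"] in auto)
      then show "Z \<union> Y \<in> J0" by simp
    qed
    moreover have "complete_ideal \<sigma> J0" unfolding complete_ideal_def using complete by blast
    ultimately obtain J and \<rho> :: "'a set rel" where J: "ideal_on A J" "complete_ideal \<sigma> J" "J0 \<subseteq> J"
      and t: "is_tcf \<mu> A J \<rho>"
      using exists_tcf[of J0 \<sigma>, OF _ _ \<sigma>(3)] by blast
    \<comment> \<open>Nullity of \<open>A - B\<close> puts \<open>B\<close>, of size less than
      \<theta>, into the dual filter, as \<open>pcf_Gamma_star\<close> requires.\<close>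
    have "E (A - B) {} = {}" unfolding E_def by blast
    then have "A - B \<in> J0"
      using J0I[of "A - B" "{}", OF _ _ fin] empty by simp
    then have "\<rho> \<in> pcf_Gamma_star \<theta> \<sigma> \<mu> A"
      unfolding pcf_Gamma_star_def using J t sub B by blast
    then obtain x where x: "x \<in> underS \<kappa> x1" "\<rho> =o seg \<kappa> x" using small by blast
    obtain f where f: "f \<in> G x" "le_mod \<mu> A J g f"
      using G(3)[OF J(1,2) is_tcf_ordIso[OF t x(2)] g] by blast
    have fF: "f \<in> F" unfolding F_def using f(1) x(1) by blast
    let ?Y = "{a \<in> A. g a \<in> under \<mu> (f a)}"
    have "E ?Y {f} = {}"
      unfolding E_def using underS_under_trans[OF wo] underS_irrefl[of _ \<mu>] by blast
    then have "?Y \<in> J0"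
      using J0I[of ?Y "{f}", OF _ _ fin] empty fF by simp
    moreover have "{a \<in> A. g a \<notin> under \<mu> (f a)} \<in> J" using f(2) unfolding le_mod_def .
    ultimately have "?Y \<union> {a \<in> A. g a \<notin> under \<mu> (f a)} \<in> J" using J(3) ideal_onD(2)[OF J(1)] by blast
    moreover have "A \<subseteq> ?Y \<union> {a \<in> A. g a \<notin> under \<mu> (f a)}" by blast
    ultimately show False using ideal_onD(1,3)[OF J(1)] by blast
  qed
  show ?thesis using FP F\<kappa> cov by (intro exI[of _ F]) blast
qed

end

section \<open>The set PP\<close>

lemma Reg_below_nonempty:
  assumes "Well_order \<mu>" "a \<in> Reg_below \<mu>"
  shows "underS \<mu> a \<noteq> {}"
proof -
  have "infinite (Field (seg \<mu> a))"
    using assms(2) unfolding Reg_below_def regular_cardinal_def cinfinite_def by blast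
  then show ?thesis using Field_seg[OF assms(1)] by auto
qed

text \<open>Where \<open>Q\<close> fails any value below \<open>a\<close> will do, and there is one
  because \<open>a\<close> is infinite.\<close>

lemma prod_ord_exists:
  assumes "Well_order \<mu>" "A \<subseteq> Reg_below \<mu>"
    and "\<And>a. a \<in> A \<Longrightarrow> Q a \<Longrightarrow> \<exists>x\<in>underS \<mu> a. R a x"
  shows "\<exists>g\<in>prod_ord \<mu> A. \<forall>a\<in>A. Q a \<longrightarrow> R a (g a)"
proof -
  have "\<exists>x\<in>underS \<mu> a. Q a \<longrightarrow> R a x" if "a \<in> A" for a
    using assms(3)[OF that] Reg_below_nonempty[OF assms(1)] that assms(2) by (cases "Q a") blast+
  then obtain h where h: "\<And>a. a \<in> A \<Longrightarrow> h a \<in> underS \<mu> a \<and> (Q a \<longrightarrow> R a (h a))" by metis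
  then have "restrict h A \<in> prod_ord \<mu> A" "\<forall>a\<in>A. Q a \<longrightarrow> R a (restrict h A a)"
    unfolding prod_ord_def by auto
  then show ?thesis by blast
qed

text \<open>For \<open>a\<close> beyond \<nu>, the set \<open>N a\<close> is too small to be
  unbounded in the regular cardinal \<open>a\<close>; the other \<open>a\<close> form a bounded
  set.\<close>

lemma eventual_bound:
  assumes \<mu>: "Cinfinite \<mu>" and A: "A \<subseteq> Reg_below \<mu>" "cofinal A \<mu>" and \<nu>: "\<nu> <o \<mu>"
    and N: "\<And>a. a \<in> A \<Longrightarrow> |N a| \<le>o \<nu>"
  shows "\<exists>g\<in>prod_ord \<mu> A. {a \<in> A. \<not> N a \<inter> underS \<mu> a \<subseteq> underS \<mu> (g a)} \<in> Jbd \<mu> A"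
proof -
  have wo: "Well_order \<mu>" using \<mu> Card_order_Well_order by blast
  obtain t where t: "t \<in> Field \<mu>" "\<nu> =o seg \<mu> t" using ordLess_ordIso_seg[OF wo \<nu>] by blast
  have "\<exists>g\<in>prod_ord \<mu> A. \<forall>a\<in>A. t \<in> underS \<mu> a \<longrightarrow> N a \<inter> underS \<mu> a \<subseteq> underS \<mu> (g a)"
  proof (rule prod_ord_exists[OF wo A(1)])
    fix a assume a: "a \<in> A" "t \<in> underS \<mu> a"
    have "|N a \<inter> underS \<mu> a| \<le>o |N a|" by (rule card_of_mono1) blast
    moreover have "|N a| \<le>o seg \<mu> t" using ordLeq_ordIso_trans[OF N[OF a(1)] t(2)] .
    moreover have "seg \<mu> t <o seg \<mu> a"
      using seg_ordLess[OF Well_order_seg[OF wo], of t a] seg_seg[OF wo a(2)] Field_seg[OF wo] a(2) by metis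
    ultimately have "|N a \<inter> underS \<mu> a| <o seg \<mu> a"
      using ordLeq_ordLess_trans ordLeq_transitive by blast
    then show "\<exists>x\<in>underS \<mu> a. N a \<inter> underS \<mu> a \<subseteq> underS \<mu> x"
      using Reg_below_bound[OF wo, of a "N a \<inter> underS \<mu> a"] a(1) A(1) by blast
  qed
  then obtain g where g: "g \<in> prod_ord \<mu> A"
    "\<And>a. a \<in> A \<Longrightarrow> t \<in> underS \<mu> a \<Longrightarrow> N a \<inter> underS \<mu> a \<subseteq> underS \<mu> (g a)" by blast
  obtain t' where t': "t' \<in> Field \<mu>" "t \<in> underS \<mu> t'"
    using infinite_Card_order_limit[of \<mu> t] \<mu> t(1) unfolding cinfinite_def underS_def by blast
  have "{a \<in> A. \<not> N a \<inter> underS \<mu> a \<subseteq> underS \<mu> (g a)} \<subseteq> underS \<mu> t'"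
  proof
    fix a assume a: "a \<in> {a \<in> A. \<not> N a \<inter> underS \<mu> a \<subseteq> underS \<mu> (g a)}"
    then have "t \<notin> underS \<mu> a" "a \<in> Field \<mu>" using g(2) A(1) unfolding Reg_below_def by blast+
    then have "a \<in> under \<mu> t" using notin_under_iff[OF wo, of a t] t(1) by blast
    then show "a \<in> underS \<mu> t'" using under_underS_trans[OF wo] t'(2) by blast
  qed
  then have "{a \<in> A. \<not> N a \<inter> underS \<mu> a \<subseteq> underS \<mu> (g a)} \<in> Jbd \<mu> A"
    using Jbd_iff[OF A(2), of "{a \<in> A. \<not> N a \<inter> underS \<mu> a \<subseteq> underS \<mu> (g a)}"] t'(1) by blast
  then show ?thesis using g(1) by blast
qed

section \<open>Members of PP and their relation to pcf\<close>

lemma PP_Gamma_regular: "\<rho> \<in> PP_Gamma \<theta> \<sigma> \<mu> \<Longrightarrow> regular_cardinal \<rho>"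
  unfolding PP_Gamma_def is_tcf_def by blast

lemma PP_Gamma_ordIso: "\<rho> \<in> PP_Gamma \<theta> \<sigma> \<mu> \<Longrightarrow> \<rho> =o \<rho>' \<Longrightarrow> \<rho>' \<in> PP_Gamma \<theta> \<sigma> \<mu>"
  unfolding PP_Gamma_def using is_tcf_ordIso by blast

text \<open>A regular \<rho> differs from the singular \<mu>. Were it smaller, a cofinal sequence
  would take at most \<rho> values at each \<open>a\<close>, so outside a bounded set one function
  would strictly exceed all its terms.\<close>

lemma PP_Gamma_gt:
  assumes \<mu>: "singular_cardinal \<mu>" and \<rho>: "\<rho> \<in> PP_Gamma \<theta> \<sigma> \<mu>"
  shows "\<mu> <o \<rho>"
proof (rule ccontr)
  assume not: "\<not> \<mu> <o \<rho>"
  have \<mu>': "Cinfinite \<mu>" "\<not> regularCard \<mu>" using \<mu> unfolding singular_cardinal_def by auto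
  have wo: "Well_order \<mu>" using \<mu>' Card_order_Well_order by blast
  obtain A J where A: "A \<subseteq> Reg_below \<mu>" "cofinal A \<mu>" and J: "ideal_on A J" "Jbd \<mu> A \<subseteq> J"
    and t: "is_tcf \<mu> A J \<rho>" using \<rho> unfolding PP_Gamma_def by blast
  have reg: "regular_cardinal \<rho>" using t unfolding is_tcf_def by blast
  have "\<rho> \<le>o \<mu>" using not ordLess_or_ordLeq[OF wo regular_cardinal_Well_order[OF reg]] by blast
  moreover have "\<not> \<rho> =o \<mu>" using \<mu>'(2) regular_cardinal_ordIso[OF reg] unfolding regular_cardinal_def by blast
  ultimately have less: "\<rho> <o \<mu>" using ordLeq_iff_ordLess_or_ordIso by blast
  obtain f where f: "\<And>i. i \<in> Field \<rho> \<Longrightarrow> f i \<in> prod_ord \<mu> A"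
    and cof: "\<And>g. g\<in>prod_ord \<mu> A \<Longrightarrow> \<exists>i\<in>Field \<rho>. le_mod \<mu> A J g (f i)"
    using t unfolding is_tcf_def by blast
  have "|(\<lambda>i. f i a) ` Field \<rho>| \<le>o \<rho>" for a
    by (rule ordLeq_ordIso_trans[OF card_of_image card_of_Field_ordIso[OF regular_cardinal_Card_order[OF reg]]])
  then obtain g where g: "g \<in> prod_ord \<mu> A"
    "{a \<in> A. \<not> (\<lambda>i. f i a) ` Field \<rho> \<inter> underS \<mu> a \<subseteq> underS \<mu> (g a)} \<in> Jbd \<mu> A" (is "?E \<in> _")
    using eventual_bound[OF \<mu>'(1) A less, of "\<lambda>a. (\<lambda>i. f i a) ` Field \<rho>"] by blast
  obtain i where i: "i \<in> Field \<rho>" "le_mod \<mu> A J g (f i)" using cof[OF g(1)] by blast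
  have "A \<subseteq> ?E \<union> {a \<in> A. g a \<notin> under \<mu> (f i a)}"
  proof
    fix a assume a: "a \<in> A"
    have "f i a \<in> underS \<mu> a" using f[OF i(1)] a unfolding prod_ord_def by blast
    then show "a \<in> ?E \<union> {a \<in> A. g a \<notin> under \<mu> (f i a)}"
      using a i(1) under_underS_trans[OF wo, of "g a" "f i a" "g a"] underS_irrefl[of "g a" \<mu>] by blast
  qed
  moreover have "?E \<union> {a \<in> A. g a \<notin> under \<mu> (f i a)} \<in> J"
    using ideal_onD(2)[OF J(1)] g(2) J(2) i(2) unfolding le_mod_def by blast
  ultimately show False using ideal_onD(1,3)[OF J(1)] by blast
qed

text \<open>The ideal is restricted to a small set \<open>B\<close> of its dual filter. As
  \<open>B\<close> is not in \<open>J\<close>, it is unbounded, hence cofinal; functions pass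
  between the products by restriction and by arbitrary extension.\<close>

lemma pcf_Gamma_star_subset_PP:
  assumes \<mu>: "Cinfinite \<mu>" and A: "A \<subseteq> Reg_below \<mu>" "cofinal A \<mu>"
  shows "pcf_Gamma_star \<theta> \<sigma> \<mu> A \<subseteq> PP_Gamma \<theta> \<sigma> \<mu>"
proof
  have wo: "Well_order \<mu>" using \<mu> Card_order_Well_order by blast
  fix \<rho> assume "\<rho> \<in> pcf_Gamma_star \<theta> \<sigma> \<mu> A"
  then obtain J B where J: "ideal_on A J" "complete_ideal \<sigma> J" "Jbd \<mu> A \<subseteq> J"
    and B: "B \<subseteq> A" "A - B \<in> J" "|B| <o \<theta>" and t: "is_tcf \<mu> A J \<rho>"
    unfolding pcf_Gamma_star_def by blast
  have BJ: "B \<notin> J"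
  proof
    assume "B \<in> J"
    then have "B \<union> (A - B) \<in> J" using ideal_onD(2)[OF J(1)] B(2) by blast
    moreover have "B \<union> (A - B) = A" using B(1) by blast
    ultimately show False using ideal_onD(3)[OF J(1)] by simp
  qed
  have cofB: "cofinal B \<mu>"
  proof (rule ccontr)
    assume "\<not> cofinal B \<mu>"
    then obtain s where s: "s \<in> Field \<mu>" "\<forall>b\<in>B. s \<notin> underS \<mu> b"
      unfolding cofinal_def underS_def by blast
    obtain s' where s': "s' \<in> Field \<mu>" "s \<in> underS \<mu> s'"
      using infinite_Card_order_limit[of \<mu> s] \<mu> s(1) unfolding cinfinite_def underS_def by blast
    have "b \<in> underS \<mu> s'" if b: "b \<in> B" for b
    proof -
      have "b \<in> Field \<mu>" using b B(1) A(1) unfolding Reg_below_def by blast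
      then have "b \<in> under \<mu> s" using notin_under_iff[OF wo, of b s] s b by blast
      then show ?thesis using under_underS_trans[OF wo] s'(2) by blast
    qed
    then have "B \<in> Jbd \<mu> A" using Jbd_iff[OF A(2), of B] B(1) s'(1) by blast
    then show False using BJ J(3) by blast
  qed
  define JB where "JB = {X. X \<in> J \<and> X \<subseteq> B}"
  have restr: "X \<in> JB" if "Y \<in> J" "X \<subseteq> Y" "X \<subseteq> B" for X Y
    unfolding JB_def using that ideal_onD(1)[OF J(1)] by blast
  have "ideal_on B JB"
  proof -
    have "JB \<subseteq> Pow B" "{} \<in> JB" "B \<notin> JB" unfolding JB_def using BJ ideal_onD(4)[OF J(1)] by blast+
    moreover have "Y \<in> JB" if "X \<in> JB" "Y \<subseteq> X" for X Y
      using restr[of X Y] that unfolding JB_def by blast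
    moreover have "X \<union> Y \<in> JB" if "X \<in> JB" "Y \<in> JB" for X Y
      using ideal_onD(2)[OF J(1)] that unfolding JB_def by blast
    ultimately show ?thesis unfolding ideal_on_def by blast
  qed
  moreover have "complete_ideal \<sigma> JB"
    using J(2) unfolding complete_ideal_def JB_def by blast
  moreover have "Jbd \<mu> B \<subseteq> JB"
  proof
    fix X assume X: "X \<in> Jbd \<mu> B"
    then have "X \<in> Jbd \<mu> A" "X \<subseteq> B" using Jbd_iff[OF A(2), of X] Jbd_iff[OF cofB, of X] B(1) by blast+
    then show "X \<in> JB" using J(3) unfolding JB_def by blast
  qed
  moreover have "is_tcf \<mu> B JB \<rho>"
  proof -
    obtain f where reg: "regular_cardinal \<rho>" and f: "\<And>i. i \<in> Field \<rho> \<Longrightarrow> f i \<in> prod_ord \<mu> A"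
      and inc: "\<And>i j. i\<in>Field \<rho> \<Longrightarrow> j\<in>Field \<rho> \<Longrightarrow> i \<in> underS \<rho> j \<Longrightarrow> less_mod \<mu> A J (f i) (f j)"
      and cof: "\<And>g. g\<in>prod_ord \<mu> A \<Longrightarrow> \<exists>i\<in>Field \<rho>. le_mod \<mu> A J g (f i)"
      using t unfolding is_tcf_def by blast
    show ?thesis unfolding is_tcf_def
    proof (intro conjI exI[of _ "\<lambda>i. restrict (f i) B"] ballI impI)
      show "regular_cardinal \<rho>" by (rule reg)
      show "restrict (f i) B \<in> prod_ord \<mu> B" if "i \<in> Field \<rho>" for i
        using f[OF that] B(1) unfolding prod_ord_def by auto
      show "less_mod \<mu> B JB (restrict (f i) B) (restrict (f j) B)"
        if "i \<in> Field \<rho>" "j \<in> Field \<rho>" "i \<in> underS \<rho> j" for i j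
        using inc[OF that] unfolding less_mod_def by (rule restr) (use B(1) in auto)
      fix g assume g: "g \<in> prod_ord \<mu> B"
      have "\<exists>g'\<in>prod_ord \<mu> A. \<forall>a\<in>A. a \<in> B \<longrightarrow> g' a = g a"
        by (rule prod_ord_exists[OF wo A(1)]) (use g in \<open>auto simp: prod_ord_def\<close>)
      then obtain g' where g': "g' \<in> prod_ord \<mu> A" "\<And>a. a \<in> B \<Longrightarrow> g' a = g a" using B(1) by blast
      obtain i where i: "i \<in> Field \<rho>" "le_mod \<mu> A J g' (f i)" using cof[OF g'(1)] by blast
      have "le_mod \<mu> B JB g (restrict (f i) B)"
        using i(2) unfolding le_mod_def by (rule restr) (use B(1) g'(2) in auto)
      then show "\<exists>i\<in>Field \<rho>. le_mod \<mu> B JB g (restrict (f i) B)" using i(1) by blast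
    qed
  qed
  ultimately show "\<rho> \<in> PP_Gamma \<theta> \<sigma> \<mu>"
    unfolding PP_Gamma_def using B A(1) cofB by blast
qed

section \<open>Covering small sets of ordinals\<close>

text \<open>The weak inequality makes this meaningful for every \<open>b\<close>: the empty set
  serves zero, and the predecessor alone serves a successor.\<close>

definition cofinal_below :: "'a rel \<Rightarrow> 'a \<Rightarrow> 'a set \<Rightarrow> bool" where
  "cofinal_below \<mu> b K \<longleftrightarrow> K \<subseteq> underS \<mu> b \<and> (\<forall>x\<in>underS \<mu> b. \<exists>k\<in>K. x \<in> under \<mu> k)"

lemma minimal_cofinal_below:
  assumes "Well_order \<mu>"
  shows "\<exists>K. cofinal_below \<mu> b K \<and> (\<forall>K'. cofinal_below \<mu> b K' \<longrightarrow> |K| \<le>o |K'| )"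
proof -
  have "cofinal_below \<mu> b (underS \<mu> b)"
    unfolding cofinal_below_def using under_refl[OF assms] underS_in_Field[of _ \<mu> b] by blast
  then have "card_of ` {K. cofinal_below \<mu> b K} \<noteq> {}" by blast
  then have "\<exists>r\<in>card_of ` {K. cofinal_below \<mu> b K}. \<forall>r'\<in>card_of ` {K. cofinal_below \<mu> b K}. r \<le>o r'"
    by (rule exists_minim_Card_order) (auto simp: card_of_Card_order card_of_card_order_on Field_card_of)
  then show ?thesis by blast
qed

text \<open>Enumerate \<open>K\<close> by a map \<open>h\<close> on the cardinal \<open>r\<close> of
  its size. By minimality the values of \<open>h\<close> before \<xi> are not cofinal, so
  \<open>c \<xi>\<close> can be put above them; a point below \<open>h \<zeta>\<close> is then below
  \<open>c \<xi>\<close> for all \<xi> past \<zeta>.\<close>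

lemma cofinality_index:
  assumes \<mu>: "Cinfinite \<mu>" and b: "b \<in> Field \<mu>" and K: "cofinal_below \<mu> b K" "infinite K"
    and min: "\<And>K'. cofinal_below \<mu> b K' \<Longrightarrow> |K| \<le>o |K'|"
  shows "\<exists>r\<in>Reg_below \<mu>. |K| =o seg \<mu> r \<and> (\<exists>c. (\<forall>\<xi>\<in>underS \<mu> r. c \<xi> \<in> underS \<mu> b) \<and>
    (\<forall>x\<in>underS \<mu> b. \<exists>\<eta>\<in>underS \<mu> r. \<forall>\<xi>\<in>underS \<mu> r. \<eta> \<in> under \<mu> \<xi> \<longrightarrow> x \<in> under \<mu> (c \<xi>)))"
proof -
  have wo: "Well_order \<mu>" using \<mu> Card_order_Well_order by blast
  have Kb: "K \<subseteq> underS \<mu> b" using K(1) unfolding cofinal_below_def by blast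
  have "|K| \<le>o |underS \<mu> b|" by (rule card_of_mono1[OF Kb])
  then have "|K| <o \<mu>" using card_of_underS[of \<mu> b] \<mu> b ordLeq_ordLess_trans by blast
  then obtain r where r: "r \<in> Field \<mu>" "|K| =o seg \<mu> r" using ordLess_ordIso_seg[OF wo] by blast
  have Cr: "Cinfinite (seg \<mu> r)"
    by (rule Cinfinite_cong[OF r(2)])
      (use K(2) in \<open>auto simp: cinfinite_def Field_card_of card_of_Card_order card_of_card_order_on\<close>)
  have Fr: "Field (seg \<mu> r) = underS \<mu> r" by (rule Field_seg[OF wo])
  have "|underS \<mu> r| =o |K|"
    using card_of_Field_ordIso[of "seg \<mu> r"] Cr Fr ordIso_transitive ordIso_symmetric[OF r(2)] by metis
  then obtain h where h: "bij_betw h (underS \<mu> r) K" using card_of_ordIso by blast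
  have "\<exists>x\<in>underS \<mu> b. h ` underS \<mu> \<xi> \<subseteq> underS \<mu> x" if \<xi>: "\<xi> \<in> underS \<mu> r" for \<xi>
  proof -
    have "|underS \<mu> \<xi>| <o seg \<mu> r"
      using card_of_underS[of "seg \<mu> r" \<xi>] Cr Fr \<xi> underS_seg[OF wo \<xi>] by simp
    then have "|h ` underS \<mu> \<xi>| <o |K|"
      using card_of_image ordLeq_ordLess_trans ordLess_ordIso_trans ordIso_symmetric[OF r(2)] by blast
    then have "\<not> cofinal_below \<mu> b (h ` underS \<mu> \<xi>)" using min not_ordLess_ordLeq by blast
    moreover have sub: "h ` underS \<mu> \<xi> \<subseteq> underS \<mu> b"
      using h Kb \<xi> underS_under_trans[OF wo _ underS_imp_under[OF \<xi>]] unfolding bij_betw_def by blast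
    ultimately obtain x where x: "x \<in> underS \<mu> b" "\<forall>k\<in>h ` underS \<mu> \<xi>. x \<notin> under \<mu> k"
      unfolding cofinal_below_def by blast
    have "k \<in> underS \<mu> x" if "k \<in> h ` underS \<mu> \<xi>" for k
      using that x notin_under_iff[OF wo, of x k] sub underS_in_Field[of _ \<mu> b] by blast
    then show ?thesis using x(1) by blast
  qed
  then obtain c where c: "\<And>\<xi>. \<xi> \<in> underS \<mu> r \<Longrightarrow> c \<xi> \<in> underS \<mu> b \<and> h ` underS \<mu> \<xi> \<subseteq> underS \<mu> (c \<xi>)"
    by metis
  have ev: "\<exists>\<eta>\<in>underS \<mu> r. \<forall>\<xi>\<in>underS \<mu> r. \<eta> \<in> under \<mu> \<xi> \<longrightarrow> x \<in> under \<mu> (c \<xi>)" if x: "x \<in> underS \<mu> b" for x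
  proof -
    obtain k where k: "k \<in> K" "x \<in> under \<mu> k" using K(1) x unfolding cofinal_below_def by blast
    obtain \<zeta> where \<zeta>: "\<zeta> \<in> underS \<mu> r" "k = h \<zeta>" using h k(1) unfolding bij_betw_def by blast
    obtain \<eta> where \<eta>: "\<eta> \<in> underS \<mu> r" "\<zeta> \<in> underS \<mu> \<eta>"
      using infinite_Card_order_limit[of "seg \<mu> r" \<zeta>] Cr Fr \<zeta>(1)
      unfolding cinfinite_def seg_def underS_def by blast
    have "x \<in> under \<mu> (c \<xi>)" if "\<xi> \<in> underS \<mu> r" "\<eta> \<in> under \<mu> \<xi>" for \<xi>
      using under_trans[OF wo k(2)] c[OF that(1)] underS_under_trans[OF wo \<eta>(2) that(2)] \<zeta>(2)
        underS_imp_under[of k \<mu> "c \<xi>"] by blast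
    then show ?thesis using \<eta>(1) by blast
  qed
  \<comment> \<open>A cofinal set \<open>L\<close> of fewer indices would be carried by
    \<open>c\<close> to a cofinal set below \<open>b\<close> smaller than \<open>K\<close>.\<close>
  have "regularCard (seg \<mu> r)" unfolding regularCard_def
  proof (intro allI impI, elim conjE, rule ccontr)
    fix L assume L: "L \<subseteq> Field (seg \<mu> r)" "cofinal L (seg \<mu> r)" "\<not> |L| =o seg \<mu> r"
    have "|L| \<le>o seg \<mu> r"
      using ordLeq_ordIso_trans[OF card_of_mono1[OF L(1)] card_of_Field_ordIso] Cr by blast
    then have "|L| <o |K|"
      using L(3) ordLeq_iff_ordLess_or_ordIso ordLess_ordIso_trans ordIso_symmetric[OF r(2)] by blast
    then have less: "|c ` L| <o |K|" using card_of_image ordLeq_ordLess_trans by blast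
    have "cofinal_below \<mu> b (c ` L)" unfolding cofinal_below_def
    proof (intro conjI ballI)
      show "c ` L \<subseteq> underS \<mu> b" using c L(1) Fr by blast
      fix x assume "x \<in> underS \<mu> b"
      then obtain \<eta> where \<eta>: "\<eta> \<in> underS \<mu> r"
        "\<And>\<xi>. \<xi> \<in> underS \<mu> r \<Longrightarrow> \<eta> \<in> under \<mu> \<xi> \<Longrightarrow> x \<in> under \<mu> (c \<xi>)" using ev by blast
      obtain l where l: "l \<in> L" "(\<eta>, l) \<in> seg \<mu> r" using L(2) \<eta>(1) Fr unfolding cofinal_def by blast
      then have "\<eta> \<in> under \<mu> l" "l \<in> underS \<mu> r" unfolding seg_def under_def by blast+
      then show "\<exists>k\<in>c ` L. x \<in> under \<mu> k" using \<eta>(2) l(1) by blast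
    qed
    then show False using min less not_ordLess_ordLeq by blast
  qed
  then have "r \<in> Reg_below \<mu>" unfolding Reg_below_def regular_cardinal_def using Cr r(1) by blast
  then show ?thesis using r(2) c ev by blast
qed

lemma card_le_underS:
  assumes wo: "Well_order \<mu>" and \<nu>: "Card_order \<nu>" "\<nu> =o seg \<mu> u" and u: "u \<in> under \<mu> \<tau>"
  shows "\<nu> \<le>o |underS \<mu> \<tau>|"
proof -
  have "|Field \<nu>| =o |underS \<mu> u|" using card_of_cong[OF \<nu>(2)] Field_seg[OF wo] by metis
  moreover have "underS \<mu> u \<subseteq> underS \<mu> \<tau>" using underS_under_trans[OF wo _ u] by blast
  ultimately have "|Field \<nu>| \<le>o |underS \<mu> \<tau>|" using ordIso_ordLeq_trans card_of_mono1 by blast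
  then show ?thesis using ordIso_ordLeq_trans[OF ordIso_symmetric[OF card_of_Field_ordIso[OF \<nu>(1)]]] by blast
qed

section \<open>Consequences of a counterexample\<close>

locale pp_counterexample =
  fixes \<sigma> :: "'s rel" and \<theta> :: "'t rel" and \<mu> :: "'a rel" and \<kappa> :: "'a set rel"
  assumes reg_\<sigma>: "regular_cardinal \<sigma>" and sing: "singular_cardinal \<mu>"
    and unc: "natLeq <o \<sigma>" and \<sigma>_cf: "\<sigma> \<le>o cf \<mu>" and cf_\<theta>: "cf \<mu> <o \<theta>" and \<theta>_\<mu>: "\<theta> <o \<mu>"
    and card_\<theta>: "Card_order \<theta>"
    and pp: "pp_Gamma \<theta> \<sigma> \<mu> =o \<kappa>" and inacc: "weakly_inaccessible \<kappa>"
    and notin: "\<kappa> \<notin> PP_Gamma \<theta> \<sigma> \<mu>"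
    and no_witness: "\<And>A. A \<subseteq> Reg_below \<mu> \<Longrightarrow> progressive \<mu> A \<Longrightarrow>
      \<not> unbounded_subset (pcf_Gamma_star \<theta> \<sigma> \<mu> A) \<kappa>"
begin

lemma Cinf: "Cinfinite \<mu>"
  using sing unfolding singular_cardinal_def by blast

lemma wo: "Well_order \<mu>"
  using Cinf Card_order_Well_order by blast

lemma reg_\<kappa>: "regular_cardinal \<kappa>" and unc_\<kappa>: "natLeq <o \<kappa>"
  using inacc unfolding weakly_inaccessible_def by blast+

lemma PP_card: "\<forall>\<rho>\<in>PP_Gamma \<theta> \<sigma> \<mu>. Card_order \<rho>"
  using PP_Gamma_regular regular_cardinal_Card_order by blast

lemma PP_less: "\<rho> \<in> PP_Gamma \<theta> \<sigma> \<mu> \<Longrightarrow> \<rho> <o \<kappa>"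
proof -
  assume \<rho>: "\<rho> \<in> PP_Gamma \<theta> \<sigma> \<mu>"
  have "\<rho> \<le>o pp_Gamma \<theta> \<sigma> \<mu>" unfolding pp_Gamma_def by (rule card_sup_props(2)[OF PP_card \<rho>])
  then have "\<rho> \<le>o \<kappa>" using pp ordLeq_ordIso_trans by blast
  moreover have "\<not> \<rho> =o \<kappa>" using PP_Gamma_ordIso[OF \<rho>] notin by blast
  ultimately show ?thesis using ordLeq_iff_ordLess_or_ordIso by blast
qed

lemma PP_unbounded:
  fixes \<nu> :: "'a set rel"
  assumes \<nu>: "Card_order \<nu>" "\<nu> <o \<kappa>"
  shows "\<exists>\<rho>\<in>PP_Gamma \<theta> \<sigma> \<mu>. \<nu> <o \<rho>"
proof (rule ccontr)
  assume not: "\<not> ?thesis"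
  have "\<forall>\<rho>\<in>PP_Gamma \<theta> \<sigma> \<mu>. \<rho> \<le>o \<nu>"
  proof
    fix \<rho> assume \<rho>: "\<rho> \<in> PP_Gamma \<theta> \<sigma> \<mu>"
    then have "Well_order \<rho>" using PP_card Card_order_Well_order by blast
    then show "\<rho> \<le>o \<nu>"
      using ordLess_or_ordLeq[OF Card_order_Well_order[OF \<nu>(1)], of \<rho>] not \<rho> by blast
  qed
  then have "pp_Gamma \<theta> \<sigma> \<mu> \<le>o \<nu>" unfolding pp_Gamma_def by (rule card_sup_props(3)[OF PP_card \<nu>(1)])
  then have "\<kappa> \<le>o \<nu>" using ordIso_ordLeq_trans[OF ordIso_symmetric[OF pp]] by blast
  then show False using \<nu>(2) not_ordLess_ordLeq by blast
qed

text \<open>PP is nonempty because its supremum is not zero, and all its members exceed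
  \<mu>.\<close>

lemma \<mu>_\<kappa>: "\<mu> <o \<kappa>"
proof -
  have "|{} :: 'a set set| <o \<kappa>"
    by (rule finite_card_of_ordLess[OF _ regular_cardinal_Cinfinite[OF reg_\<kappa>]]) simp
  then obtain \<rho> where "\<rho> \<in> PP_Gamma \<theta> \<sigma> \<mu>" using PP_unbounded[OF card_of_Card_order] by blast
  then show ?thesis using PP_Gamma_gt[OF sing] PP_less ordLess_transitive by blast
qed

text \<open>An infinite successor cardinal is regular and so cannot be the singular \<mu>.\<close>

lemma cardSuc_less:
  assumes N: "infinite N" "|N| <o \<mu>"
  shows "cardSuc |N| <o \<mu>"
proof -
  have "cardSuc |N| \<le>o \<mu>" using cardSuc_least[OF card_of_Card_order _ N(2)] Cinf by blast
  moreover have "\<not> cardSuc |N| =o \<mu>"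
  proof
    assume iso: "cardSuc |N| =o \<mu>"
    have C: "Cinfinite |N|" using N(1) by (simp add: cinfinite_def Field_card_of card_of_Card_order card_of_card_order_on)
    have "regularCard \<mu>"
      by (rule regularCard_ordIso[OF iso Cinfinite_cardSuc[OF C] regularCard_cardSuc[OF C]])
    then show False using sing unfolding singular_cardinal_def by blast
  qed
  ultimately show ?thesis using ordLeq_iff_ordLess_or_ordIso by blast
qed

section \<open>Cofinal sets of single ordinals\<close>

definition cofset :: "'a \<Rightarrow> 'a set" where
  "cofset b = (SOME K. cofinal_below \<mu> b K \<and> (\<forall>K'. cofinal_below \<mu> b K' \<longrightarrow> |K| \<le>o |K'| ))"

lemma cofset: "cofinal_below \<mu> b (cofset b)" "cofinal_below \<mu> b K' \<Longrightarrow> |cofset b| \<le>o |K'|"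
  using someI_ex[OF minimal_cofinal_below[OF wo, of b]] unfolding cofset_def by blast+

text \<open>The map \<open>c\<close> replaces an increasing enumeration of a cofinal set; it need not be monotone.\<close>

definition is_climb :: "'a \<Rightarrow> 'a \<Rightarrow> ('a \<Rightarrow> 'a) \<Rightarrow> bool" where
  "is_climb b r c \<longleftrightarrow> r \<in> Reg_below \<mu> \<and> |cofset b| =o seg \<mu> r \<and> (\<forall>\<xi>\<in>underS \<mu> r. c \<xi> \<in> underS \<mu> b) \<and>
    (\<forall>x\<in>underS \<mu> b. \<exists>\<eta>\<in>underS \<mu> r. \<forall>\<xi>\<in>underS \<mu> r. \<eta> \<in> under \<mu> \<xi> \<longrightarrow> x \<in> under \<mu> (c \<xi>))"

definition cof :: "'a \<Rightarrow> 'a" where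
  "cof b = (SOME r. \<exists>c. is_climb b r c)"

definition climb :: "'a \<Rightarrow> 'a \<Rightarrow> 'a" where
  "climb b = (SOME c. is_climb b (cof b) c)"

lemma climb:
  assumes "b \<in> Field \<mu>" "infinite (cofset b)"
  shows "is_climb b (cof b) (climb b)"
proof -
  have "\<exists>r c. is_climb b r c"
    using cofinality_index[OF Cinf assms(1) cofset(1) assms(2) cofset(2)] unfolding is_climb_def by blast
  then have "\<exists>c. is_climb b (cof b) c" unfolding cof_def by (rule someI_ex)
  then show ?thesis unfolding climb_def by (rule someI_ex)
qed

section \<open>Small cofinal sets of ordinals and their large cofinalities\<close>

definition N0 :: "'a set" where
  "N0 = (SOME N. N \<subseteq> Field \<mu> \<and> cofinal N \<mu> \<and> cf \<mu> = |N| )"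

lemma N0: "N0 \<subseteq> Field \<mu>" "cofinal N0 \<mu>" "cf \<mu> = |N0|"
  using someI_ex[OF cf_props(1)[OF Cinf]] unfolding N0_def by blast+

text \<open>Containing \<open>N0\<close> gives each ordinal an upper bound in \<open>N\<close> and
  makes \<open>N\<close> infinite.\<close>

definition D :: "'a set set" where
  "D = {N. N0 \<subseteq> N \<and> N \<subseteq> Field \<mu> \<and> |N| <o \<mu>}"

lemma D_iff: "N \<in> D \<longleftrightarrow> N0 \<subseteq> N \<and> N \<subseteq> Field \<mu> \<and> |N| <o \<mu>"
  unfolding D_def by simp

lemma N0_D: "N0 \<in> D"
  using N0 ordLess_transitive[OF cf_\<theta> \<theta>_\<mu>] unfolding D_iff by simp

lemma cinfinite_\<sigma>_mono: "\<sigma> \<le>o |X| \<Longrightarrow> infinite X"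
  using cinfinite_mono[of \<sigma> "|X|"] regular_cardinal_Cinfinite[OF reg_\<sigma>]
  by (auto simp: cinfinite_def Field_card_of)

lemma infinite_D: "N \<in> D \<Longrightarrow> infinite N"
  using cinfinite_\<sigma>_mono[of N0] \<sigma>_cf N0(3) finite_subset unfolding D_iff by auto

text \<open>As \<open>|cofs N| \<le> |N|\<close>, the first lower bound provides the condition
  \<open>large\<close> of \<open>pcf_product\<close>. The second lets fewer than \<theta> ordinals
  below a member be bounded in it.\<close>

definition cofs :: "'a set \<Rightarrow> 'a set" where
  "cofs N = {a \<in> Reg_below \<mu>. (\<exists>b\<in>N. infinite (cofset b) \<and> a = cof b) \<and>
     cardSuc |N| <o seg \<mu> a \<and> \<theta> <o seg \<mu> a}"

lemma cofs_Reg: "cofs N \<subseteq> Reg_below \<mu>"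
  unfolding cofs_def by blast

text \<open>If \<open>cofs N\<close> is bounded, a bound \<open>t\<close> and the empty family do.
  Otherwise \<open>cofs N\<close> is progressive and cofinal, its pcf lies in PP and hence below
  \<kappa>, so the failure of unboundedness provides the \<beta> for
  \<open>covering_family\<close>.\<close>

lemma covering_family_cofs:
  assumes N: "N \<in> D"
  shows "\<exists>F. F \<subseteq> prod_ord \<mu> (cofs N) \<and> |F| <o \<kappa> \<and>
    (\<forall>g\<in>prod_ord \<mu> (cofs N). \<forall>B. B \<subseteq> cofs N \<and> |B| <o \<theta> \<longrightarrow>
      (\<exists>S. S \<subseteq> F \<and> |S| <o \<sigma> \<and> (\<exists>t\<in>Field \<mu>. {a \<in> B. \<forall>f\<in>S. f a \<in> underS \<mu> (g a)} \<subseteq> under \<mu> t)))"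
proof (cases "cofinal (cofs N) \<mu>")
  case False
  then obtain t where t: "t \<in> Field \<mu>" "\<forall>a\<in>cofs N. t \<notin> underS \<mu> a"
    unfolding cofinal_def underS_def by blast
  have "a \<in> under \<mu> t" if "a \<in> cofs N" for a
    using notin_under_iff[OF wo, of a t] t that cofs_Reg unfolding Reg_below_def by blast
  moreover have "|{} :: ('a \<Rightarrow> 'a) set| <o \<kappa>" "|{} :: ('a \<Rightarrow> 'a) set| <o \<sigma>"
    using finite_card_of_ordLess regular_cardinal_Cinfinite reg_\<kappa> reg_\<sigma> by blast+
  ultimately show ?thesis using t(1) by (intro exI[of _ "{}"]) auto
next
  case cof: True
  let ?A = "cofs N"
  have cfA: "cf \<mu> \<le>o |?A|"
    by (rule cf_props(2)[OF Cinf _ cof]) (use cofs_Reg in \<open>auto simp: Reg_below_def\<close>)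
  have \<sigma>A: "\<sigma> \<le>o |?A|" by (rule ordLeq_transitive[OF \<sigma>_cf cfA])
  have infA: "infinite ?A" by (rule cinfinite_\<sigma>_mono[OF \<sigma>A])
  have "?A \<subseteq> cof ` N" unfolding cofs_def by blast
  then have AN: "|?A| \<le>o |N|" using ordLeq_transitive[OF card_of_mono1 card_of_image] by blast
  have SucAN: "cardSuc |?A| \<le>o cardSuc |N|"
    using AN cardSuc_mono_ordLeq[OF card_of_Card_order card_of_Card_order] by blast
  interpret pcf_product \<mu> ?A
  proof
    show "Cinfinite \<mu>" "infinite ?A" "?A \<subseteq> Reg_below \<mu>" using Cinf infA cofs_Reg by auto
    show "cardSuc |?A| <o seg \<mu> a" if "a \<in> ?A" for a
      using that ordLeq_ordLess_trans[OF SucAN] unfolding cofs_def by blast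
  qed
  have "wo_rel.minim \<mu> ?A \<in> ?A"
    by (rule wo_rel.minim_in) (use wo infA cofs_Reg in \<open>auto simp: wo_rel_def Reg_below_def\<close>)
  then have "|?A| <o seg \<mu> (wo_rel.minim \<mu> ?A)"
    using ordLess_transitive[OF cardSuc_greater[OF card_of_Card_order] large] by blast
  then have "progressive \<mu> ?A" unfolding progressive_def using infA cofs_Reg by auto
  then have "\<not> unbounded_subset (pcf_Gamma_star \<theta> \<sigma> \<mu> ?A) \<kappa>" using no_witness cofs_Reg by blast
  moreover have sub: "pcf_Gamma_star \<theta> \<sigma> \<mu> ?A \<subseteq> PP_Gamma \<theta> \<sigma> \<mu>"
    by (rule pcf_Gamma_star_subset_PP[OF Cinf cofs_Reg cof])
  ultimately obtain \<beta> :: "'a set rel" where \<beta>: "Well_order \<beta>" "\<beta> <o \<kappa>"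
    "\<And>\<rho>. \<rho> \<in> pcf_Gamma_star \<theta> \<sigma> \<mu> ?A \<Longrightarrow> \<not> \<beta> <o \<rho>"
    unfolding unbounded_subset_def using PP_less by blast
  have bnd: "\<rho> \<le>o \<beta>" if \<rho>: "\<rho> \<in> pcf_Gamma_star \<theta> \<sigma> \<mu> ?A" for \<rho>
    using ordLess_or_ordLeq[OF \<beta>(1), of \<rho>] \<beta>(3)[OF \<rho>] sub \<rho> PP_card Card_order_Well_order by blast
  from covering_family[where \<theta> = \<theta>, OF reg_\<sigma> \<sigma>_cf \<sigma>A reg_\<kappa> cof \<beta>(2) bnd]
  obtain F where F: "F \<subseteq> P" "|F| <o \<kappa>" and cov: "\<forall>g\<in>P. \<forall>B. B \<subseteq> ?A \<and> |B| <o \<theta> \<longrightarrow>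
    (\<exists>S. S \<subseteq> F \<and> |S| <o \<sigma> \<and> {a \<in> B. \<forall>f\<in>S. f a \<in> underS \<mu> (g a)} \<in> Jbd \<mu> ?A)"
    by blast
  have cov': "\<exists>S. S \<subseteq> F \<and> |S| <o \<sigma> \<and> (\<exists>t\<in>Field \<mu>. {a \<in> B. \<forall>f\<in>S. f a \<in> underS \<mu> (g a)} \<subseteq> under \<mu> t)"
    if g: "g \<in> P" and B: "B \<subseteq> ?A" "|B| <o \<theta>" for g B
  proof -
    obtain S where S: "S \<subseteq> F" "|S| <o \<sigma>" "{a \<in> B. \<forall>f\<in>S. f a \<in> underS \<mu> (g a)} \<in> Jbd \<mu> ?A"
      using cov[rule_format, OF g conjI[OF B]] by blast
    from S(3) obtain t where t: "t \<in> Field \<mu>" "{a \<in> B. \<forall>f\<in>S. f a \<in> underS \<mu> (g a)} \<subseteq> underS \<mu> t"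
      unfolding Jbd_iff[OF cof] by blast
    have "{a \<in> B. \<forall>f\<in>S. f a \<in> underS \<mu> (g a)} \<subseteq> under \<mu> t"
      using t(2) underS_imp_under[of _ \<mu> t] by blast
    then show ?thesis using S(1,2) t(1) by blast
  qed
  show ?thesis by (rule exI[of _ F]) (intro conjI F ballI allI impI, elim conjE, rule cov')
qed

section \<open>Refinements of a small set\<close>

definition dominators :: "'a set \<Rightarrow> ('a \<Rightarrow> 'a) set" where
  "dominators N = (SOME F. F \<subseteq> prod_ord \<mu> (cofs N) \<and> |F| <o \<kappa> \<and>
    (\<forall>g\<in>prod_ord \<mu> (cofs N). \<forall>B. B \<subseteq> cofs N \<and> |B| <o \<theta> \<longrightarrow>
      (\<exists>S. S \<subseteq> F \<and> |S| <o \<sigma> \<and> (\<exists>t\<in>Field \<mu>. {a \<in> B. \<forall>f\<in>S. f a \<in> underS \<mu> (g a)} \<subseteq> under \<mu> t))))"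

lemma dominators:
  assumes "N \<in> D"
  shows "dominators N \<subseteq> prod_ord \<mu> (cofs N)" "|dominators N| <o \<kappa>"
    "g \<in> prod_ord \<mu> (cofs N) \<Longrightarrow> B \<subseteq> cofs N \<Longrightarrow> |B| <o \<theta> \<Longrightarrow>
      \<exists>S. S \<subseteq> dominators N \<and> |S| <o \<sigma> \<and> (\<exists>t\<in>Field \<mu>. {a \<in> B. \<forall>f\<in>S. f a \<in> underS \<mu> (g a)} \<subseteq> under \<mu> t)"
proof -
  note dominators = someI_ex[OF covering_family_cofs[OF assms], folded dominators_def]
  show "dominators N \<subseteq> prod_ord \<mu> (cofs N)" "|dominators N| <o \<kappa>" using dominators by simp_all
  assume "g \<in> prod_ord \<mu> (cofs N)" "B \<subseteq> cofs N" "|B| <o \<theta>"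
  then show "\<exists>S. S \<subseteq> dominators N \<and> |S| <o \<sigma> \<and> (\<exists>t\<in>Field \<mu>. {a \<in> B. \<forall>f\<in>S. f a \<in> underS \<mu> (g a)} \<subseteq> under \<mu> t)"
    using dominators by simp
qed

text \<open>
  \<open>fill\<close> adds whole cofinal sets for the points of \<open>N\<close> of small cofinality, \<open>refine\<close> adds one point
  below each point of large cofinality, as prescribed by \<open>s\<close>.
\<close>

definition fill :: "'a set \<Rightarrow> 'a \<Rightarrow> 'a set" where
  "fill N \<tau> = N \<union> (\<Union>b\<in>{b \<in> N. |cofset b| \<le>o |underS \<mu> \<tau>|}. cofset b)"

definition refine :: "'a set \<Rightarrow> ('a \<Rightarrow> 'a) \<Rightarrow> 'a set" where
  "refine N s = N \<union> (\<lambda>b. climb b (s (cof b))) ` {b \<in> N. infinite (cofset b) \<and> cof b \<in> cofs N}"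

definition succs :: "'a set \<Rightarrow> 'a set set" where
  "succs N = fill N ` Field \<mu> \<union> refine N ` dominators N"

lemma cofset_underS: "cofset b \<subseteq> underS \<mu> b"
  using cofset(1)[of b] unfolding cofinal_below_def by blast

lemma fill_D:
  assumes N: "N \<in> D" and \<tau>: "\<tau> \<in> Field \<mu>"
  shows "fill N \<tau> \<in> D"
proof -
  let ?B = "{b \<in> N. |cofset b| \<le>o |underS \<mu> \<tau>|}"
  have inf\<mu>: "infinite (Field \<mu>)" and C\<mu>: "Card_order \<mu>" using Cinf unfolding cinfinite_def by auto
  have NF: "|N| <o \<mu>" using N unfolding D_iff by blast
  have \<tau>F: "|underS \<mu> \<tau>| <o \<mu>" by (rule card_of_underS[OF C\<mu> \<tau>])
  have BN: "|?B| \<le>o |N|" by (rule card_of_mono1) blast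
  have "|\<Union>b\<in>?B. cofset b| <o \<mu>"
  proof (cases "|underS \<mu> \<tau>| \<le>o |N|")
    case True
    have "|\<Union>b\<in>?B. cofset b| \<le>o |N|"
      by (rule card_of_UNION_ordLeq_infinite[OF infinite_D[OF N] BN]) (use True ordLeq_transitive in blast)
    then show ?thesis using NF ordLeq_ordLess_trans by blast
  next
    case False
    then have le: "|N| \<le>o |underS \<mu> \<tau>|"
      using ordLeq_total[OF card_of_Well_order card_of_Well_order] by blast
    have "infinite (underS \<mu> \<tau>)" using card_of_ordLeq_infinite[OF le infinite_D[OF N]] .
    then have "|\<Union>b\<in>?B. cofset b| \<le>o |underS \<mu> \<tau>|"
      by (rule card_of_UNION_ordLeq_infinite[OF _ ordLeq_transitive[OF BN le]]) blast
    then show ?thesis using \<tau>F ordLeq_ordLess_trans by blast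
  qed
  then have "|fill N \<tau>| <o \<mu>" unfolding fill_def
    by (rule card_of_Un_ordLess_infinite_Field[OF inf\<mu> C\<mu> NF])
  moreover have "cofset b \<subseteq> Field \<mu>" for b
    using cofset_underS[of b] underS_in_Field[of _ \<mu> b] by blast
  ultimately show ?thesis using N unfolding D_iff fill_def by blast
qed

lemma refine_D:
  assumes N: "N \<in> D" and s: "s \<in> prod_ord \<mu> (cofs N)"
  shows "refine N s \<in> D"
proof -
  let ?B = "{b \<in> N. infinite (cofset b) \<and> cof b \<in> cofs N}"
  have inf\<mu>: "infinite (Field \<mu>)" and C\<mu>: "Card_order \<mu>" using Cinf unfolding cinfinite_def by auto
  have NF: "|N| <o \<mu>" "N \<subseteq> Field \<mu>" using N unfolding D_iff by auto
  have "|?B| \<le>o |N|" by (rule card_of_mono1) blast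
  then have "|(\<lambda>b. climb b (s (cof b))) ` ?B| <o \<mu>"
    using ordLeq_ordLess_trans[OF ordLeq_transitive[OF card_of_image] NF(1)] by blast
  then have "|refine N s| <o \<mu>" unfolding refine_def
    by (rule card_of_Un_ordLess_infinite_Field[OF inf\<mu> C\<mu> NF(1)])
  moreover have "climb b (s (cof b)) \<in> Field \<mu>" if b: "b \<in> ?B" for b
  proof -
    have "s (cof b) \<in> underS \<mu> (cof b)" using s b unfolding prod_ord_def by blast
    moreover have "is_climb b (cof b) (climb b)" by (rule climb) (use b NF(2) in auto)
    ultimately show ?thesis unfolding is_climb_def using underS_in_Field[of _ \<mu> b] by blast
  qed
  ultimately show ?thesis using N unfolding D_iff refine_def by blast
qed

lemma succs_D:
  assumes N: "N \<in> D"
  shows "succs N \<subseteq> D \<and> |succs N| <o \<kappa>"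
proof
  show "succs N \<subseteq> D" unfolding succs_def using fill_D[OF N] refine_D[OF N] dominators(1)[OF N] by blast
  have "|fill N ` Field \<mu>| \<le>o \<mu>"
    using ordLeq_ordIso_trans[OF card_of_image card_of_Field_ordIso] Cinf by blast
  then have 1: "|fill N ` Field \<mu>| <o \<kappa>" using \<mu>_\<kappa> ordLeq_ordLess_trans by blast
  have 2: "|refine N ` dominators N| <o \<kappa>" using card_of_image dominators(2)[OF N] ordLeq_ordLess_trans by blast
  show "|succs N| <o \<kappa>" unfolding succs_def
    by (rule card_of_Un_ordLess_infinite_Field[OF _ _ 1 2])
      (use regular_cardinal_Cinfinite[OF reg_\<kappa>] in \<open>auto simp: cinfinite_def\<close>)
qed

section \<open>Descent of upper approximations\<close>

text \<open>For \<open>N\<close> in \<open>D\<close> it equals \<open>x\<close> exactly when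
  \<open>x\<close> is in \<open>N\<close>; otherwise its decrease measures progress.\<close>

definition ceil :: "'a set \<Rightarrow> 'a \<Rightarrow> 'a" where
  "ceil N x = wo_rel.minim \<mu> {n \<in> N. x \<in> under \<mu> n}"

lemma ceil:
  assumes N: "N \<in> D" and x: "x \<in> Field \<mu>"
  shows "ceil N x \<in> N" "x \<in> under \<mu> (ceil N x)" "n \<in> N \<Longrightarrow> x \<in> under \<mu> n \<Longrightarrow> ceil N x \<in> under \<mu> n"
proof -
  have w: "wo_rel \<mu>" using wo unfolding wo_rel_def .
  have sub: "{n \<in> N. x \<in> under \<mu> n} \<subseteq> Field \<mu>" using N unfolding D_iff by blast
  obtain n0 where "n0 \<in> N0" "x \<in> under \<mu> n0" using N0(2) x unfolding cofinal_def under_def by blast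
  then have "{n \<in> N. x \<in> under \<mu> n} \<noteq> {}" using N unfolding D_iff by blast
  then have "ceil N x \<in> {n \<in> N. x \<in> under \<mu> n}"
    unfolding ceil_def by (rule wo_rel.minim_in[OF w sub])
  then show "ceil N x \<in> N" "x \<in> under \<mu> (ceil N x)" by blast+
  show "ceil N x \<in> under \<mu> n" if "n \<in> N" "x \<in> under \<mu> n"
    using wo_rel.minim_least[OF w sub, of n] that unfolding ceil_def under_def by blast
qed

text \<open>Let \<open>\<beta> a\<close> be the approximation of \<open>f a\<close> in
  \<open>N\<close>. If its cofinality is at most \<tau>, \<open>fill\<close> adds a whole cofinal
  set below it. If larger, \<open>f a\<close> is passed by the climbing map from some index
  \<open>\<eta> a\<close> on; one function \<open>g\<close> bounds these indices, and fewer than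
  \<sigma> dominators reach \<open>g\<close> at all cofinalities beyond \<open>t\<close>.\<close>

lemma descend:
  assumes N: "N \<in> D" and C: "|C| <o \<theta>" and f: "\<And>a. a \<in> C \<Longrightarrow> f a \<in> Field \<mu>"
  shows "\<exists>\<T>. \<T> \<subseteq> succs N \<and> |\<T>| <o \<sigma> \<and>
    (\<forall>a\<in>C. f a \<in> N \<or> (\<exists>N'\<in>\<T>. ceil N' (f a) \<in> underS \<mu> (ceil N (f a))))"
proof -
  define \<beta> where "\<beta> a = ceil N (f a)" for a
  have NF: "N \<subseteq> Field \<mu>" "|N| <o \<mu>" using N unfolding D_iff by auto
  have \<beta>: "\<beta> a \<in> N" "f a \<in> under \<mu> (\<beta> a)" "\<beta> a \<in> Field \<mu>" if "a \<in> C" for a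
    unfolding \<beta>_def using ceil[OF N f[OF that]] NF by blast+
  define C' where "C' = {a \<in> C. f a \<in> underS \<mu> (\<beta> a) \<and> infinite (cofset (\<beta> a)) \<and> cof (\<beta> a) \<in> cofs N}"
  have "\<exists>\<eta>\<in>underS \<mu> (cof (\<beta> a)). \<forall>\<xi>\<in>underS \<mu> (cof (\<beta> a)). \<eta> \<in> under \<mu> \<xi> \<longrightarrow> f a \<in> under \<mu> (climb (\<beta> a) \<xi>)"
    if a: "a \<in> C'" for a
  proof -
    have "is_climb (\<beta> a) (cof (\<beta> a)) (climb (\<beta> a))"
      by (rule climb) (use a \<beta>(3) in \<open>auto simp: C'_def\<close>)
    then show ?thesis using a unfolding is_climb_def C'_def by blast
  qed
  then obtain \<eta> where \<eta>: "\<And>a. a \<in> C' \<Longrightarrow> \<eta> a \<in> underS \<mu> (cof (\<beta> a))"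
    "\<And>a \<xi>. a \<in> C' \<Longrightarrow> \<xi> \<in> underS \<mu> (cof (\<beta> a)) \<Longrightarrow> \<eta> a \<in> under \<mu> \<xi> \<Longrightarrow> f a \<in> under \<mu> (climb (\<beta> a) \<xi>)"
    by metis
  have C'\<theta>: "|C'| <o \<theta>"
    by (rule ordLeq_ordLess_trans[OF card_of_mono1 C]) (auto simp: C'_def)
  \<comment> \<open>Many \<open>a\<close> may share a cofinality \<open>r\<close>, but they are
    fewer than \<theta>, which is below \<open>r\<close>; so their indices have a common
    bound.\<close>
  have "\<exists>g\<in>prod_ord \<mu> (cofs N). \<forall>r\<in>cofs N. True \<longrightarrow> \<eta> ` {a \<in> C'. cof (\<beta> a) = r} \<subseteq> underS \<mu> (g r)"
  proof (rule prod_ord_exists[OF wo cofs_Reg])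
    fix r assume r: "r \<in> cofs N"
    have "|{a \<in> C'. cof (\<beta> a) = r}| \<le>o |C'|" by (rule card_of_mono1) blast
    then have "|\<eta> ` {a \<in> C'. cof (\<beta> a) = r}| <o \<theta>"
      using ordLeq_ordLess_trans[OF ordLeq_transitive[OF card_of_image] C'\<theta>] by blast
    moreover have "\<theta> <o seg \<mu> r" using r unfolding cofs_def by blast
    ultimately have "|\<eta> ` {a \<in> C'. cof (\<beta> a) = r}| <o seg \<mu> r" using ordLess_transitive by blast
    then show "\<exists>x\<in>underS \<mu> r. \<eta> ` {a \<in> C'. cof (\<beta> a) = r} \<subseteq> underS \<mu> x"
      using Reg_below_bound[OF wo, of r "\<eta> ` {a \<in> C'. cof (\<beta> a) = r}"] r cofs_Reg \<eta>(1) by blast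
  qed
  then obtain g where g: "g \<in> prod_ord \<mu> (cofs N)" "\<And>a. a \<in> C' \<Longrightarrow> \<eta> a \<in> underS \<mu> (g (cof (\<beta> a)))"
    unfolding C'_def by blast
  let ?B = "(\<lambda>a. cof (\<beta> a)) ` C'"
  have "?B \<subseteq> cofs N" unfolding C'_def by blast
  moreover have "|?B| <o \<theta>" using card_of_image C'\<theta> ordLeq_ordLess_trans by blast
  ultimately obtain S t where S: "S \<subseteq> dominators N" "|S| <o \<sigma>" and t: "t \<in> Field \<mu>"
    "{a \<in> ?B. \<forall>s\<in>S. s a \<in> underS \<mu> (g a)} \<subseteq> under \<mu> t"
    using dominators(3)[OF N g(1), of ?B] by blast
  obtain t1 where t1: "t1 \<in> Field \<mu>" "cardSuc |N| =o seg \<mu> t1"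
    using ordLess_ordIso_seg[OF wo cardSuc_less[OF infinite_D[OF N] NF(2)]] by blast
  obtain t2 where t2: "t2 \<in> Field \<mu>" "\<theta> =o seg \<mu> t2" using ordLess_ordIso_seg[OF wo \<theta>_\<mu>] by blast
  have "|{t, t1, t2}| <o cf \<mu>"
    by (rule ordLess_ordLeq_trans[OF finite_card_of_ordLess[OF _ regular_cardinal_Cinfinite[OF reg_\<sigma>]] \<sigma>_cf]) simp
  \<comment> \<open>The threshold lies past three ordinals: \<open>t\<close>, where the dominators
    may fail, and \<open>|N|^+\<close> and \<theta>, so that every cofinality above it qualifies for
    \<open>cofs N\<close>.\<close>
  then obtain \<tau> where \<tau>: "\<tau> \<in> Field \<mu>" "t \<in> under \<mu> \<tau>" "t1 \<in> under \<mu> \<tau>" "t2 \<in> under \<mu> \<tau>"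
    using bound_below_cf[OF Cinf, of "{t, t1, t2}"] t(1) t1(1) t2(1) by auto
  have \<tau>N: "cardSuc |N| \<le>o |underS \<mu> \<tau>|"
    by (rule card_le_underS[OF wo cardSuc_Card_order[OF card_of_Card_order] t1(2) \<tau>(3)])
  have \<tau>\<theta>: "\<theta> \<le>o |underS \<mu> \<tau>|" by (rule card_le_underS[OF wo card_\<theta> t2(2) \<tau>(4)])
  define \<T> where "\<T> = insert (fill N \<tau>) (refine N ` S)"
  have sub: "\<T> \<subseteq> succs N" unfolding \<T>_def succs_def using \<tau>(1) S(1) by blast
  have "|{fill N \<tau>}| <o \<sigma>"
    by (rule finite_card_of_ordLess[OF _ regular_cardinal_Cinfinite[OF reg_\<sigma>]]) simp
  moreover have "|refine N ` S| <o \<sigma>" by (rule ordLeq_ordLess_trans[OF card_of_image S(2)])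
  ultimately have "|{fill N \<tau>} \<union> refine N ` S| <o \<sigma>"
    by (intro card_of_Un_ordLess_infinite_Field) (use regular_cardinal_Cinfinite[OF reg_\<sigma>] in \<open>auto simp: cinfinite_def\<close>)
  then have card: "|\<T>| <o \<sigma>" unfolding \<T>_def by simp
  have "\<exists>N'\<in>\<T>. ceil N' (f a) \<in> underS \<mu> (ceil N (f a))" if a: "a \<in> C" "f a \<notin> N" for a
  proof -
    have fa: "f a \<in> underS \<mu> (\<beta> a)"
      using \<beta>(1,2)[OF a(1)] a(2) unfolding under_def underS_def by auto
    have "\<exists>N'\<in>\<T>. \<exists>n\<in>N'. f a \<in> under \<mu> n \<and> n \<in> underS \<mu> (\<beta> a)"
    proof (cases "|cofset (\<beta> a)| \<le>o |underS \<mu> \<tau>|")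
      case True
      obtain k where k: "k \<in> cofset (\<beta> a)" "f a \<in> under \<mu> k"
        using cofset(1)[of "\<beta> a"] fa unfolding cofinal_below_def by blast
      have "k \<in> fill N \<tau>" unfolding fill_def using k(1) True \<beta>(1)[OF a(1)] by blast
      then show ?thesis using k cofset_underS unfolding \<T>_def by blast
    next
      case False
      then have big: "|underS \<mu> \<tau>| <o |cofset (\<beta> a)|"
        using ordLess_or_ordLeq[OF card_of_Well_order card_of_Well_order] by blast
      have N\<beta>: "cardSuc |N| <o |cofset (\<beta> a)|" and \<theta>\<beta>: "\<theta> <o |cofset (\<beta> a)|"
        using ordLeq_ordLess_trans[OF \<tau>N big] ordLeq_ordLess_trans[OF \<tau>\<theta> big] by auto
      have "|N| \<le>o |cofset (\<beta> a)|"
        using ordLess_imp_ordLeq[OF ordLess_transitive[OF cardSuc_greater[OF card_of_Card_order] N\<beta>]] .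
      then have inf: "infinite (cofset (\<beta> a))" using card_of_ordLeq_infinite infinite_D[OF N] by blast
      let ?r = "cof (\<beta> a)"
      have cl: "is_climb (\<beta> a) ?r (climb (\<beta> a))" by (rule climb[OF \<beta>(3)[OF a(1)] inf])
      then have r: "?r \<in> Reg_below \<mu>" "|cofset (\<beta> a)| =o seg \<mu> ?r" unfolding is_climb_def by auto
      have rN: "?r \<in> cofs N" unfolding cofs_def
        using r(1) inf \<beta>(1)[OF a(1)] ordLess_ordIso_trans[OF N\<beta> r(2)] ordLess_ordIso_trans[OF \<theta>\<beta> r(2)] by blast
      have aC: "a \<in> C'" unfolding C'_def using a(1) fa inf rN by blast
      \<comment> \<open>The cofinality exceeds the threshold, so it avoids the exceptional set, and
        some \<open>s\<close> in \<open>S\<close> is at least \<open>g\<close> there.\<close>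
      have "?r \<notin> under \<mu> t"
      proof
        assume "?r \<in> under \<mu> t"
        then have "?r \<in> under \<mu> \<tau>" using under_trans[OF wo] \<tau>(2) by blast
        then have "underS \<mu> ?r \<subseteq> underS \<mu> \<tau>" using underS_under_trans[OF wo] by blast
        then have "|underS \<mu> ?r| \<le>o |underS \<mu> \<tau>|" by (rule card_of_mono1)
        moreover have "|cofset (\<beta> a)| =o |underS \<mu> ?r|"
          using r(2) ordIso_symmetric[OF Reg_below_card[OF wo r(1)]] ordIso_transitive by blast
        ultimately show False using False ordIso_ordLeq_trans by blast
      qed
      then have "?r \<notin> {a \<in> ?B. \<forall>s\<in>S. s a \<in> underS \<mu> (g a)}" using t(2) by blast
      then obtain s where s: "s \<in> S" "s ?r \<notin> underS \<mu> (g ?r)" using aC by blast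
      have sP: "s \<in> prod_ord \<mu> (cofs N)" using s(1) S(1) dominators(1)[OF N] by blast
      have sr: "s ?r \<in> underS \<mu> ?r" using sP rN unfolding prod_ord_def by blast
      have gr: "g ?r \<in> underS \<mu> ?r" using g(1) rN unfolding prod_ord_def by blast
      have "g ?r \<in> under \<mu> (s ?r)"
        using notin_under_iff[OF wo, of "g ?r" "s ?r"] s(2) sr gr underS_in_Field[of _ \<mu> ?r] by blast
      then have "\<eta> a \<in> under \<mu> (s ?r)"
        using underS_imp_under[OF underS_under_trans[OF wo g(2)[OF aC]]] by blast
      then have "f a \<in> under \<mu> (climb (\<beta> a) (s ?r))" using \<eta>(2)[OF aC sr] by blast
      moreover have "climb (\<beta> a) (s ?r) \<in> underS \<mu> (\<beta> a)" using cl sr unfolding is_climb_def by blast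
      moreover have "climb (\<beta> a) (s ?r) \<in> refine N s"
        unfolding refine_def using \<beta>(1)[OF a(1)] inf rN by blast
      ultimately show ?thesis using s(1) unfolding \<T>_def by blast
    qed
    then obtain N' n where N': "N' \<in> \<T>" "n \<in> N'" "f a \<in> under \<mu> n" "n \<in> underS \<mu> (\<beta> a)" by blast
    have "N' \<in> D" using N'(1) sub succs_D[OF N] by blast
    then have "ceil N' (f a) \<in> under \<mu> n" using ceil(3)[OF _ f[OF a(1)]] N'(2,3) by blast
    then have "ceil N' (f a) \<in> underS \<mu> (\<beta> a)" using under_underS_trans[OF wo] N'(4) by blast
    then show ?thesis using N'(1) unfolding \<beta>_def by blast
  qed
  then show ?thesis using sub card by (intro exI[of _ \<T>]) blast
qed

text \<open>Starting from \<open>N0\<close>, repeated descents stay within fewer than \<sigma>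
  members of \<open>X\<close>, as \<sigma> is regular and uncountable. For each \<open>a\<close> a
  member with the least \<open>ceil\<close> admits no improvement, so it contains
  \<open>f a\<close>.\<close>

lemma covered:
  assumes X: "X \<subseteq> D" "N0 \<in> X" "\<And>N. N \<in> X \<Longrightarrow> succs N \<subseteq> X"
    and C: "|C| <o \<theta>" and f: "\<And>a. a \<in> C \<Longrightarrow> f a \<in> Field \<mu>"
  shows "\<exists>Y. Y \<subseteq> X \<and> |Y| <o \<sigma> \<and> (\<forall>a\<in>C. \<exists>N\<in>Y. f a \<in> N)"
proof -
  have "\<exists>\<T>. \<T> \<subseteq> succs N \<and> |\<T>| <o \<sigma> \<and>
    (\<forall>a\<in>C. f a \<in> N \<or> (\<exists>N'\<in>\<T>. ceil N' (f a) \<in> underS \<mu> (ceil N (f a))))" if "N \<in> X" for N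
    using descend[of N C f] X(1) C f that by blast
  then obtain T where T: "\<And>N. N \<in> X \<Longrightarrow> T N \<subseteq> succs N \<and> |T N| <o \<sigma> \<and>
    (\<forall>a\<in>C. f a \<in> N \<or> (\<exists>N'\<in>T N. ceil N' (f a) \<in> underS \<mu> (ceil N (f a))))"
    by metis
  have TX: "T N \<subseteq> X \<and> |T N| <o \<sigma>" if "N \<in> X" for N using T[OF that] X(3)[OF that] by blast
  obtain Y where Y: "N0 \<in> Y" "Y \<subseteq> X" "|Y| <o \<sigma>" "\<And>N. N \<in> Y \<Longrightarrow> T N \<subseteq> Y"
    using small_closed_set[of \<sigma> X T N0, OF reg_\<sigma> unc TX X(2)] by blast
  have "\<exists>N\<in>Y. f a \<in> N" if a: "a \<in> C" for a
  proof -
    have w: "wo_rel \<mu>" using wo unfolding wo_rel_def .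
    let ?V = "(\<lambda>N. ceil N (f a)) ` Y"
    have VF: "?V \<subseteq> Field \<mu>"
    proof
      fix v assume "v \<in> ?V"
      then obtain N where "N \<in> Y" "v = ceil N (f a)" by blast
      moreover then have "N \<in> D" using Y(2) X(1) by blast
      ultimately show "v \<in> Field \<mu>" using ceil(1)[of N "f a"] f[OF a] unfolding D_iff by blast
    qed
    have ne: "?V \<noteq> {}" using Y(1) by blast
    from wo_rel.minim_in[OF w VF ne] obtain N where N: "N \<in> Y" "wo_rel.minim \<mu> ?V = ceil N (f a)" by blast
    have "\<not> ceil N' (f a) \<in> underS \<mu> (ceil N (f a))" if N': "N' \<in> Y" for N'
    proof
      assume l: "ceil N' (f a) \<in> underS \<mu> (ceil N (f a))"
      have "(ceil N (f a), ceil N' (f a)) \<in> \<mu>"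
        using wo_rel.minim_least[OF w VF, of "ceil N' (f a)"] N' N(2) by simp
      then have "ceil N (f a) \<in> under \<mu> (ceil N' (f a))" unfolding under_def by simp
      then show False using under_underS_trans[OF wo _ l] underS_irrefl[of _ \<mu>] by blast
    qed
    then have "f a \<in> N" using T[of N] N(1) Y(2) Y(4)[OF N(1)] a by blast
    then show ?thesis using N(1) by blast
  qed
  then show ?thesis using Y(2,3) by blast
qed

section \<open>The final contradiction\<close>

lemma contradiction: False
proof -
  obtain X where X: "N0 \<in> X" "X \<subseteq> D" "|X| <o \<kappa>" "\<And>N. N \<in> X \<Longrightarrow> succs N \<subseteq> X"
    using small_closed_set[of \<kappa> D succs N0, OF reg_\<kappa> unc_\<kappa> succs_D N0_D] by blast
  obtain \<rho> where \<rho>: "\<rho> \<in> PP_Gamma \<theta> \<sigma> \<mu>" "|X| <o \<rho>" using PP_unbounded[OF card_of_Card_order X(3)] by blast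
  then obtain C J where C: "C \<subseteq> Reg_below \<mu>" "cofinal C \<mu>" "|C| <o \<theta>"
    and J: "ideal_on C J" "complete_ideal \<sigma> J" "Jbd \<mu> C \<subseteq> J" and t: "is_tcf \<mu> C J \<rho>"
    unfolding PP_Gamma_def by blast
  obtain f where reg: "regular_cardinal \<rho>" and f: "\<And>i. i \<in> Field \<rho> \<Longrightarrow> f i \<in> prod_ord \<mu> C"
    and inc: "\<And>i j. i\<in>Field \<rho> \<Longrightarrow> j\<in>Field \<rho> \<Longrightarrow> i \<in> underS \<rho> j \<Longrightarrow> less_mod \<mu> C J (f i) (f j)"
    and cof: "\<And>g. g\<in>prod_ord \<mu> C \<Longrightarrow> \<exists>i\<in>Field \<rho>. le_mod \<mu> C J g (f i)"
    using t unfolding is_tcf_def by blast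
  \<comment> \<open>\<open>g\<close> bounds the part of \<open>N\<close> below almost every
    \<open>a\<close>, and \<open>i\<close> is an index at which the cofinal sequence has reached
    \<open>g\<close>.\<close>
  define R where "R N g i \<longleftrightarrow> g \<in> prod_ord \<mu> C \<and>
      {a \<in> C. \<not> N \<inter> underS \<mu> a \<subseteq> underS \<mu> (g a)} \<in> J \<and> i \<in> Field \<rho> \<and> le_mod \<mu> C J g (f i)" for N g i
  have "\<exists>g i. R N g i" if N: "N \<in> X" for N
  proof -
    have "|N| <o \<mu>" using N X(2) unfolding D_def by blast
    then obtain g where "g \<in> prod_ord \<mu> C" "{a \<in> C. \<not> N \<inter> underS \<mu> a \<subseteq> underS \<mu> (g a)} \<in> Jbd \<mu> C"
      using eventual_bound[OF Cinf C(1,2), of "|N|" "\<lambda>_. N"] ordLeq_reflexive[OF card_of_Well_order] by blast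
    then show ?thesis unfolding R_def using cof[of g] J(3) by blast
  qed
  then obtain g i where "\<And>N. N \<in> X \<Longrightarrow> R N (g N) (i N)" by metis
  note gi = this[unfolded R_def]
  have "|i ` X| <o \<rho>" using card_of_image \<rho>(2) ordLeq_ordLess_trans by blast
  \<comment> \<open>Here \<open>|X|\<close> < \<rho> is used: one term of the sequence lies past the
    bounds for all members of \<open>X\<close>.\<close>
  then obtain j where j: "j \<in> Field \<rho>" "i ` X \<subseteq> underS \<rho> j"
    using regular_cardinal_bound[OF reg, of "i ` X"] gi by blast
  have fj: "f j a \<in> underS \<mu> a" if "a \<in> C" for a using f[OF j(1)] that unfolding prod_ord_def by blast
  have fjF: "f j a \<in> Field \<mu>" if "a \<in> C" for a using fj[OF that] underS_in_Field[of _ \<mu> a] by blast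
  obtain Y where Y: "Y \<subseteq> X" "|Y| <o \<sigma>" "\<And>a. a \<in> C \<Longrightarrow> \<exists>N\<in>Y. f j a \<in> N"
    using covered[of X C "f j", OF X(2,1,4) C(3) fjF] by blast
  \<comment> \<open>Off a null set, a value \<open>f j a\<close> in \<open>N\<close> would be below
    \<open>g N a\<close>, which is at most \<open>f (i N) a\<close> and hence below
    \<open>f j a\<close> itself.\<close>
  have "{a \<in> C. f j a \<in> N} \<in> J" if N: "N \<in> Y" for N
  proof -
    have NX: "N \<in> X" using N Y(1) by blast
    let ?E = "{a \<in> C. \<not> N \<inter> underS \<mu> a \<subseteq> underS \<mu> (g N a)}"
    let ?L = "{a \<in> C. g N a \<notin> under \<mu> (f (i N) a)}" and ?M = "{a \<in> C. f (i N) a \<notin> underS \<mu> (f j a)}"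
    have "?L \<in> J" "?E \<in> J" using gi[OF NX] unfolding le_mod_def by auto
    moreover have "?M \<in> J" using inc[of "i N" j] gi[OF NX] j NX unfolding less_mod_def by blast
    ultimately have U: "?E \<union> (?L \<union> ?M) \<in> J" using ideal_onD(2)[OF J(1)] by blast
    have "{a \<in> C. f j a \<in> N} \<subseteq> ?E \<union> (?L \<union> ?M)"
    proof (rule subsetI, rule ccontr)
      fix a assume a: "a \<in> {a \<in> C. f j a \<in> N}" "a \<notin> ?E \<union> (?L \<union> ?M)"
      then have "f j a \<in> underS \<mu> (g N a)" using fj by blast
      moreover have "g N a \<in> underS \<mu> (f j a)" using a under_underS_trans[OF wo] by blast
      ultimately show False
        using under_underS_trans[OF wo underS_imp_under[of _ \<mu>]] underS_irrefl[of _ \<mu>] by blast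
    qed
    then show ?thesis using ideal_onD(1)[OF J(1) U] by blast
  qed
  then have "(\<lambda>N. {a \<in> C. f j a \<in> N}) ` Y \<subseteq> J" by blast
  moreover have "|(\<lambda>N. {a \<in> C. f j a \<in> N}) ` Y| <o \<sigma>" by (rule ordLeq_ordLess_trans[OF card_of_image Y(2)])
  ultimately have "\<Union>((\<lambda>N. {a \<in> C. f j a \<in> N}) ` Y) \<in> J" using J(2) unfolding complete_ideal_def by blast
  moreover have "C \<subseteq> \<Union>((\<lambda>N. {a \<in> C. f j a \<in> N}) ` Y)" using Y(3) by blast
  ultimately show False using ideal_onD(1,3)[OF J(1)] by blast
qed

end

theorem theorem6p4:
  fixes \<sigma> :: "'s rel" and \<theta> :: "'t rel" and \<mu> :: "'a rel" and \<kappa> :: "'a set rel"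
  assumes "regular_cardinal \<sigma>" and "regular_cardinal \<theta>" and "singular_cardinal \<mu>"
    and "natLeq <o \<sigma>" and "\<sigma> \<le>o cf \<mu>" and "cf \<mu> <o \<theta>" and "\<theta> <o \<mu>"
    and "pp_Gamma \<theta> \<sigma> \<mu> =o \<kappa>" and "weakly_inaccessible \<kappa>"
    and "\<kappa> \<notin> PP_Gamma \<theta> \<sigma> \<mu>"
  shows "\<exists>A. A \<subseteq> Reg_below \<mu> \<and> progressive \<mu> A \<and>
           unbounded_subset (pcf_Gamma_star \<theta> \<sigma> \<mu> A) \<kappa>"
proof (rule ccontr)
  assume not: "\<not> ?thesis"
  interpret pp_counterexample \<sigma> \<theta> \<mu> \<kappa>
    by (intro pp_counterexample.intro assms regular_cardinal_Card_order[OF assms(2)]) (use not in blast)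
  show False by (rule contradiction)
qed

end
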